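(* Let $d\ge 2$, let $D$ be a $d$-ary tree with at least two leaves, and let $D_1,D_2,\ldots,D_d$ be its branches (some of which might be empty). Let $m_j$ be the number of branches with $j$ leaves, for every $j\ge 0$. Then $$I_d(D)\le\frac{|M(D)|\prod_{j\ge 0}m_j!}{d!}\prod_{i=1}^d I_d(D_i).$$ If branches with the same number of leaves are isomorphic, then this reduces to $$I_d(D)\le\prod_{i=1}^d I_d(D_i).$$
   Context: A $d$-ary tree is a finite rooted tree in which every internal (non-leaf) vertex has at least two and at most $d$ children; a single vertex is a $d$-ary tree with one leaf, and the empty tree with $0$ leaves is also allowed. Isomorphism means root-preserving isomorphism (two empty trees are isomorphic). $\|T\|$ denotes the number of leaves of $T$. A set $S$ of leaves of $T$ induces a $d$-ary tree: take the smallest subtree of $T$ containing all leaves in $S$ (rooted at the most recent common ancestor of $S$) and repeatedly suppress every vertex with exactly one child (contracting its two adjacent edges to a single edge). $c(D,T)$ is the number of sets of $\|D\|$ leaves of $T$ that induce a tree isomorphic to $D$, and $\gamma(D,T)=c(D,T)/\binom{\|T\|}{\|D\|}$. The $d$-ary inducibility of a nonempty $d$-ary tree $D$ is $$I_d(D)=\limsup_{n\to\infty}\ \max_{\substack{\|T\|=n\\ T\ d\text{-ary tree}}}\gamma(D,T),$$ and $I_d(D)=1$ if $D$ is empty. The branches of a $d$-ary tree $D$ with at least two leaves are the components (rooted at the children of the root) obtained on removing the root; the list is padded with empty trees to have exactly $d$ entries $D_1,\ldots,D_d$. On the set of permutations of $[d]=\{1,\ldots,d\}$ define $\pi\sim_D\pi'$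 if $D_{\pi(j)}$ is isomorphic to $D_{\pi'(j)}$ for every $j\in[d]$; $M(D)$ is a complete set of representatives of the equivalence classes of $\sim_D$. *)

theory Defs
  imports
    Complex_Main
    "HOL-Library.Extended_Real"
    "HOL-Library.Groups_Big_Fun"
    "HOL-Combinatorics.Permutations"
begin

text \<open>
  Children are kept in a list, but the order is immaterial: trees are only compared up to
  isomorphism. The leaf is \<open>Node []\<close>. Vertices are addressed by the path of child indices from
  the root. The possibly empty trees are the elements of \<open>rtree option\<close>, where \<open>None\<close> is the
  empty tree.
\<close>

datatype rtree = Node "rtree list"

fun children :: "rtree \<Rightarrow> rtree list" where
  "children (Node ts) = ts"

fun dary :: "nat \<Rightarrow> rtree \<Rightarrow> bool" where
  "dary d (Node ts) \<longleftrightarrow>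
     (ts = [] \<or> 2 \<le> length ts \<and> length ts \<le> d) \<and> (\<forall>t\<in>set ts. dary d t)"

abbreviation dary_tree :: "nat \<Rightarrow> rtree option \<Rightarrow> bool" where
  "dary_tree d \<equiv> pred_option (dary d)"

fun is_vertex :: "rtree \<Rightarrow> nat list \<Rightarrow> bool" where
  "is_vertex t [] \<longleftrightarrow> True"
| "is_vertex (Node ts) (i # p) \<longleftrightarrow> i < length ts \<and> is_vertex (ts ! i) p"

fun vertices :: "rtree option \<Rightarrow> nat list set" where
  "vertices None = {}"
| "vertices (Some t) = {p. is_vertex t p}"

definition leaves :: "rtree option \<Rightarrow> nat list set" where
  "leaves T = {p \<in> vertices T. \<forall>i. p @ [i] \<notin> vertices T}"

definition num_leaves :: "rtree option \<Rightarrow> nat" where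
  "num_leaves T = card (leaves T)"

definition adjacent :: "nat list \<Rightarrow> nat list \<Rightarrow> bool" where
  "adjacent p q \<longleftrightarrow> (\<exists>i. q = p @ [i] \<or> p = q @ [i])"

definition isomorphic :: "rtree option \<Rightarrow> rtree option \<Rightarrow> bool" where
  "isomorphic T U \<longleftrightarrow>
     (\<exists>f. bij_betw f (vertices T) (vertices U) \<and>
          ([] \<in> vertices T \<longrightarrow> f [] = []) \<and>
          (\<forall>p\<in>vertices T. \<forall>q\<in>vertices T. adjacent p q \<longleftrightarrow> adjacent (f p) (f q)))"

text \<open>
  For a nonempty set \<open>S\<close> of leaves of \<open>t\<close>, \<open>spanned S t\<close> is the union of the paths from the root
  to the leaves in \<open>S\<close>. Suppressing its vertices with exactly one child, the root included, moves
  the root to the most recent common ancestor of \<open>S\<close>.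
\<close>

function spanned :: "nat list set \<Rightarrow> rtree \<Rightarrow> rtree" where
  "spanned S (Node ts) =
     Node (map (\<lambda>i. spanned {p. i # p \<in> S} (ts ! i))
               (filter (\<lambda>i. \<exists>p. i # p \<in> S) [0..<length ts]))"
  by pat_completeness auto
termination
proof (relation "measure (\<lambda>(S, t). size t)", simp, clarsimp)
  fix ts :: "rtree list" and i
  assume "i < length ts"
  then have "size (ts ! i) \<le> size_list size ts"
    by (metis nth_mem order_refl size_list_estimation')
  then show "size (ts ! i) < Suc (size_list size ts)"
    by simp
qed

fun suppress :: "rtree \<Rightarrow> rtree" where
  "suppress (Node [t]) = suppress t"
| "suppress (Node ts) = Node (map suppress ts)"

definition induced :: "nat list set \<Rightarrow> rtree option \<Rightarrow> rtree option" where
  "induced S T = (if S = {} then None else map_option (\<lambda>t. suppress (spanned S t)) T)"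

definition copies :: "rtree option \<Rightarrow> rtree option \<Rightarrow> nat" where
  "copies D T =
     card {S. S \<subseteq> leaves T \<and> card S = num_leaves D \<and> isomorphic (induced S T) D}"

definition density :: "rtree option \<Rightarrow> rtree option \<Rightarrow> real" where
  "density D T = real (copies D T) / real (num_leaves T choose num_leaves D)"

text \<open>
  The upper limit is taken in the extended reals, as \<^typ>\<open>real\<close> is not a complete lattice; all
  densities lie between 0 and 1, so it is finite. For fixed \<open>n\<close> the densities form a finite set
  (rationals in [0,1] with a common denominator), which is nonempty when \<open>d\<close> is at least 2, so
  \<open>Max\<close> is the true maximum.
\<close>

definition inducibility :: "nat \<Rightarrow> rtree option \<Rightarrow> real" where
  "inducibility d D =
     (if D = None then 1
      else real_of_ereal (limsup (\<lambda>n.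
        ereal (Max (density D ` {T. dary_tree d T \<and> num_leaves T = n})))))"

text \<open>The \<open>d\<close> branches are indexed from 0.\<close>

definition branch :: "nat \<Rightarrow> rtree \<Rightarrow> nat \<Rightarrow> rtree option" where
  "branch d D i = (map Some (children D) @ replicate (d - length (children D)) None) ! i"

definition perm_equiv :: "nat \<Rightarrow> rtree \<Rightarrow> (nat \<Rightarrow> nat) \<Rightarrow> (nat \<Rightarrow> nat) \<Rightarrow> bool" where
  "perm_equiv d D \<pi> \<pi>' \<longleftrightarrow> (\<forall>j<d. isomorphic (branch d D (\<pi> j)) (branch d D (\<pi>' j)))"

definition representatives :: "nat \<Rightarrow> rtree \<Rightarrow> (nat \<Rightarrow> nat) set \<Rightarrow> bool" where
  "representatives d D M \<longleftrightarrow>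
     M \<subseteq> {\<pi>. \<pi> permutes {..<d}} \<and>
     (\<forall>\<pi>. \<pi> permutes {..<d} \<longrightarrow> (\<exists>!\<rho>. \<rho> \<in> M \<and> perm_equiv d D \<pi> \<rho>))"

definition num_branches :: "nat \<Rightarrow> rtree \<Rightarrow> nat \<Rightarrow> nat" where
  "num_branches d D j = card {i. i < d \<and> num_leaves (branch d D i) = j}"

end

theory Submission
  imports Defs
begin

text \<open>
  A copy of \<open>D\<close> in \<open>T\<close> either lies inside one branch of \<open>T\<close>, or distributes the branches of \<open>D\<close>
  over the branches of \<open>T\<close> according to a unique element of \<open>M(D)\<close>. Bounding the number of
  copies of \<open>D\<^sub>i\<close> in a tree with \<open>m\<close> leaves by \<open>(I\<^sub>d(D\<^sub>i) + \<epsilon>) (m choose \<parallel>D\<^sub>i\<parallel>)\<close> plus a constant turns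
  this into a recursion for the number of copies of \<open>D\<close>. Each vector of branch sizes of \<open>D\<close> arises
  from the same number of elements of \<open>M(D)\<close>, and distinct vectors count disjoint families of leaf
  sets of size \<open>k = \<parallel>D\<parallel>\<close>, so the main terms telescope to a multiple of \<open>n choose k\<close>. The errors
  contribute at most a constant times \<open>n ^ (k - 2)\<close> per internal vertex, in total \<open>O(n ^ (k - 1))\<close>.
\<close>

section \<open>Trees, leaves and isomorphisms\<close>

text \<open>The constant in the bound is a group index. Let H be the group of permutations of
  \<open>{..<d}\<close> that preserve the branches of \<open>D\<close> up to isomorphism, and G the
  larger group that preserves only their leaf counts. The classes of \<open>perm_equiv\<close> are
  cosets of H, so |M| = d!/|H|, and each vector of branch sizes belongs to |G|/|H| = |M| |G| / d!
  elements of \<open>M\<close>. The order of G is at most the product of the m_j!, and G = H under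
  the extra assumption of the second claim, which leaves the factor 1. The additive constants are
  unavoidable because the density bound holds only for trees with many leaves, while some branches
  of T may be small. Replacing a factor of order n^q by a constant costs nothing dangerous for q
  \<ge> 2, but for q = 1 the errors of all internal vertices could add up to the order of the main
  term.\<close>

lemma finite_is_vertex: "finite {p. is_vertex t p}"
proof (induction t)
  case (Node ts)
  have "{p. is_vertex (Node ts) p} \<subseteq> insert [] (\<Union>i<length ts. (#) i ` {p. is_vertex (ts ! i) p})"
  proof
    fix p assume "p \<in> {p. is_vertex (Node ts) p}"
    then show "p \<in> insert [] (\<Union>i<length ts. (#) i ` {p. is_vertex (ts ! i) p})"
      by (cases p) auto
  qed
  then show ?case
  proof (rule finite_subset)
    have "finite {p. is_vertex (ts ! i) p}" if "i < length ts" for i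
      using Node that by simp
    then show "finite (insert [] (\<Union>i<length ts. (#) i ` {p. is_vertex (ts ! i) p}))"
      by blast
  qed
qed

lemma finite_vertices: "finite (vertices T)"
  by (cases T) (auto simp: finite_is_vertex)

lemma finite_leaves: "finite (leaves T)"
  unfolding leaves_def by (rule finite_subset[OF _ finite_vertices[of T]]) auto

lemma is_vertex_appendD: "is_vertex t (p @ q) \<Longrightarrow> is_vertex t p"
  by (induction t p rule: is_vertex.induct) auto

lemma vertices_appendD: "p @ q \<in> vertices T \<Longrightarrow> p \<in> vertices T"
  by (cases T) (auto dest: is_vertex_appendD)

lemma leaves_None: "leaves None = {}"
  by (simp add: leaves_def)

lemma leaves_leaf: "leaves (Some (Node [])) = {[]}"
proof -
  have "is_vertex (Node []) p \<longleftrightarrow> p = []" for p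
    by (cases p) auto
  then show ?thesis
    by (auto simp: leaves_def)
qed

lemma Cons_in_leaves:
  "i # p \<in> leaves (Some (Node ts)) \<longleftrightarrow> i < length ts \<and> p \<in> leaves (Some (ts ! i))"
  by (auto simp: leaves_def)

lemma Nil_in_leaves: "[] \<in> leaves (Some (Node ts)) \<longleftrightarrow> ts = []"
  by (auto simp: leaves_def)

lemma leaves_Node:
  assumes "ts \<noteq> []"
  shows "leaves (Some (Node ts)) = (\<Union>i<length ts. (#) i ` leaves (Some (ts ! i)))"
proof (rule set_eqI)
  fix p
  show "p \<in> leaves (Some (Node ts)) \<longleftrightarrow> p \<in> (\<Union>i<length ts. (#) i ` leaves (Some (ts ! i)))"
    using assms by (cases p) (auto simp: Cons_in_leaves Nil_in_leaves)
qed

lemma num_leaves_None: "num_leaves None = 0"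
  by (simp add: num_leaves_def leaves_None)

lemma num_leaves_leaf: "num_leaves (Some (Node [])) = 1"
  by (simp add: num_leaves_def leaves_leaf)

lemma num_leaves_Node:
  assumes "ts \<noteq> []"
  shows "num_leaves (Some (Node ts)) = (\<Sum>i<length ts. num_leaves (Some (ts ! i)))"
  unfolding num_leaves_def leaves_Node[OF assms]
  by (subst card_UN_disjoint) (auto simp: finite_leaves card_image)

lemma num_leaves_pos: "num_leaves (Some t) > 0"
proof (induction t)
  case (Node ts)
  show ?case
  proof (cases "ts = []")
    case False
    then have "num_leaves (Some (ts ! 0)) > 0"
      using Node by simp
    then show ?thesis
      using False by (auto simp: num_leaves_Node intro: sum_pos2[of _ 0])
  qed (simp add: num_leaves_leaf)
qed

section \<open>Rooted isomorphisms\<close>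

lemma isomorphic_refl: "isomorphic T T"
  unfolding isomorphic_def by (rule exI[of _ id]) auto

lemma isomorphic_sym:
  assumes "isomorphic T U"
  shows "isomorphic U T"
proof -
  obtain f where f: "bij_betw f (vertices T) (vertices U)" "[] \<in> vertices T \<longrightarrow> f [] = []"
    "\<forall>p\<in>vertices T. \<forall>q\<in>vertices T. adjacent p q \<longleftrightarrow> adjacent (f p) (f q)"
    using assms unfolding isomorphic_def by blast
  define g where "g = the_inv_into (vertices T) f"
  have bij: "bij_betw g (vertices U) (vertices T)"
    unfolding g_def by (rule bij_betw_the_inv_into[OF f(1)])
  have fg: "f (g p) = p" if "p \<in> vertices U" for p
    unfolding g_def using f(1) that by (meson bij_betw_def f_the_inv_into_f_bij_betw)
  have gU: "g p \<in> vertices T" if "p \<in> vertices U" for p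
    using bij that by (rule bij_betwE[THEN bspec])
  have "g [] = []" if "[] \<in> vertices U"
  proof -
    have "[] \<in> vertices T"
      using vertices_appendD[of "[]" "g []" T] gU[OF that] by simp
    then show ?thesis
      using f(1,2) unfolding g_def by (metis bij_betw_imp_inj_on the_inv_into_f_f)
  qed
  moreover have "adjacent p q \<longleftrightarrow> adjacent (g p) (g q)" if "p \<in> vertices U" "q \<in> vertices U" for p q
    using f(3) gU[OF that(1)] gU[OF that(2)] fg that by auto
  ultimately show ?thesis
    unfolding isomorphic_def using bij by blast
qed

lemma isomorphic_trans:
  assumes "isomorphic T U" "isomorphic U V"
  shows "isomorphic T V"
proof -
  obtain f where f: "bij_betw f (vertices T) (vertices U)" "[] \<in> vertices T \<longrightarrow> f [] = []"
    "\<forall>p\<in>vertices T. \<forall>q\<in>vertices T. adjacent p q \<longleftrightarrow> adjacent (f p) (f q)"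
    using assms unfolding isomorphic_def by blast
  obtain g where g: "bij_betw g (vertices U) (vertices V)" "[] \<in> vertices U \<longrightarrow> g [] = []"
    "\<forall>p\<in>vertices U. \<forall>q\<in>vertices U. adjacent p q \<longleftrightarrow> adjacent (g p) (g q)"
    using assms unfolding isomorphic_def by blast
  have fU: "f p \<in> vertices U" if "p \<in> vertices T" for p
    using bij_betwE[OF f(1)] that by blast
  have "bij_betw (g \<circ> f) (vertices T) (vertices V)"
    using f(1) g(1) by (rule bij_betw_trans)
  moreover have "[] \<in> vertices T \<longrightarrow> (g \<circ> f) [] = []"
    using f(2) g(2) fU by fastforce
  moreover have "\<forall>p\<in>vertices T. \<forall>q\<in>vertices T. adjacent p q \<longleftrightarrow> adjacent ((g \<circ> f) p) ((g \<circ> f) q)"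
    using f(3) g(3) fU by simp
  ultimately show ?thesis
    unfolding isomorphic_def by blast
qed

text \<open>An isomorphism moves edges to edges and fixes the root, hence by induction on the depth it
  respects the orientation of edges.\<close>

lemma root_preserving_child:
  assumes inj: "inj_on f (vertices T)"
    and root: "[] \<in> vertices T \<longrightarrow> f [] = []"
    and adj: "\<forall>p\<in>vertices T. \<forall>q\<in>vertices T. adjacent p q \<longleftrightarrow> adjacent (f p) (f q)"
    and "p @ [i] \<in> vertices T"
  shows "\<exists>j. f (p @ [i]) = f p @ [j]"
  using assms(4)
proof (induction p arbitrary: i rule: rev_induct)
  case Nil
  then have "[] \<in> vertices T"
    using vertices_appendD[of "[]"] by simp
  moreover have "adjacent (f []) (f ([] @ [i]))"
    using adj Nil calculation unfolding adjacent_def by (metis append_Nil)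
  ultimately show ?case
    using root by (auto simp: adjacent_def)
next
  case (snoc l p)
  have v: "p @ [l] \<in> vertices T" "p \<in> vertices T"
    using snoc.prems vertices_appendD by blast+
  obtain j where j: "f (p @ [l]) = f p @ [j]"
    using snoc.IH v(1) by blast
  have "adjacent (f (p @ [l])) (f ((p @ [l]) @ [i]))"
    using adj v(1) snoc.prems unfolding adjacent_def by metis
  moreover have False if "f (p @ [l]) = f ((p @ [l]) @ [i]) @ [m]" for m
  proof -
    have "f ((p @ [l]) @ [i]) = f p"
      using that j by simp
    then show False
      using inj_onD[OF inj] snoc.prems v(2) by fastforce
  qed
  ultimately show ?case
    unfolding adjacent_def by blast
qed

lemma isomorphic_None_iff: "isomorphic None T \<longleftrightarrow> T = None"
proof
  assume "isomorphic None T"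
  then have "vertices T = {}"
    by (auto simp: isomorphic_def bij_betw_def)
  then show "T = None"
    by (cases T) (auto dest: spec[of _ "[]"])
qed (simp add: isomorphic_refl)

text \<open>If a preimage of a leaf had a child, that child would be mapped to a child of the leaf.
  So every leaf of \<open>U\<close> is the image of a leaf of \<open>T\<close>; the other inequality
  follows by symmetry.\<close>

lemma isomorphic_num_leaves_le:
  assumes "isomorphic T U"
  shows "num_leaves U \<le> num_leaves T"
proof -
  obtain f where f: "bij_betw f (vertices T) (vertices U)" "[] \<in> vertices T \<longrightarrow> f [] = []"
    "\<forall>p\<in>vertices T. \<forall>q\<in>vertices T. adjacent p q \<longleftrightarrow> adjacent (f p) (f q)"
    using assms unfolding isomorphic_def by blast
  have inj: "inj_on f (vertices T)"
    using f(1) by (simp add: bij_betw_def)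
  have "leaves U \<subseteq> f ` leaves T"
  proof
    fix q assume q: "q \<in> leaves U"
    then obtain p where p: "p \<in> vertices T" "q = f p"
      using f(1) unfolding leaves_def bij_betw_def by blast
    have "p @ [i] \<notin> vertices T" for i
    proof
      assume i: "p @ [i] \<in> vertices T"
      then obtain j where "f (p @ [i]) = q @ [j]"
        using root_preserving_child[OF inj f(2,3)] p by blast
      then show False
        using q i f(1) bij_betwE unfolding leaves_def by fastforce
    qed
    then show "q \<in> f ` leaves T"
      using p by (auto simp: leaves_def)
  qed
  then show ?thesis
    unfolding num_leaves_def using finite_leaves by (metis card_image_le card_mono finite_imageI order_trans)
qed

lemma isomorphic_num_leaves: "isomorphic T U \<Longrightarrow> num_leaves T = num_leaves U"
  by (meson isomorphic_num_leaves_le isomorphic_sym order_antisym)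

text \<open>Edges keep their direction, so depth-one vertices go to depth-one vertices, and what
  lies below \<open>[i]\<close> goes below some \<open>[g i]\<close>. Deleting the first index on
  both sides leaves an isomorphism between the two subtrees.\<close>

lemma isomorphic_Node_children:
  assumes "isomorphic (Some (Node ts)) (Some (Node us))"
  shows "\<exists>g. bij_betw g {..<length ts} {..<length us} \<and>
    (\<forall>i<length ts. isomorphic (Some (ts ! i)) (Some (us ! g i)))"
proof -
  let ?T = "vertices (Some (Node ts))" and ?U = "vertices (Some (Node us))"
  obtain f where f: "bij_betw f ?T ?U" "[] \<in> ?T \<longrightarrow> f [] = []"
    "\<forall>p\<in>?T. \<forall>q\<in>?T. adjacent p q \<longleftrightarrow> adjacent (f p) (f q)"
    using assms unfolding isomorphic_def by blast
  have inj: "inj_on f ?T" and img: "f ` ?T = ?U"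
    using f(1) by (simp_all add: bij_betw_def)
  have root: "f [] = []"
    using f(2) by simp
  note child = root_preserving_child[OF inj f(2,3)]
  define g where "g i = hd (f [i])" for i
  \<comment> \<open>Each further step of the path appends one index to the image, so the first index
    of the image stays \<open>g i\<close>.\<close>
  have shift: "\<exists>r. f (i # p) = g i # r" if "i # p \<in> ?T" for i p
    using that
  proof (induction p rule: rev_induct)
    case Nil
    then show ?case
      using child[of "[]" i] by (auto simp: g_def root)
  next
    case (snoc x p)
    have "i # p \<in> ?T"
      using snoc.prems vertices_appendD[of "i # p" "[x]" "Some (Node ts)"] by (simp del: vertices.simps)
    with snoc.IH obtain r where "f (i # p) = g i # r"
      by blast
    moreover obtain j where "f ((i # p) @ [x]) = f (i # p) @ [j]"
      using child[of "i # p" x] snoc.prems by auto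
    ultimately show ?case
      by simp
  qed
  define h where "h i p = tl (f (i # p))" for i p
  have fh: "f (i # p) = g i # h i p" if "i # p \<in> ?T" for i p
    using shift[OF that] by (auto simp: h_def)
  have h_Nil: "h i [] = []" if "i < length ts" for i
    using child[of "[]" i] that by (auto simp: h_def root)
  have f_single: "f [i] = [g i]" if "i < length ts" for i
    using fh[of i "[]"] h_Nil[OF that] that by simp
  have g_less: "g i < length us" if "i < length ts" for i
  proof -
    have "[i] \<in> ?T"
      using that by simp
    then have "[g i] \<in> ?U"
      using img f_single[OF that] by (metis imageI)
    then show ?thesis
      by simp
  qed
  have inj_g: "inj_on g {..<length ts}"
  proof (rule inj_onI)
    fix i j assume "i \<in> {..<length ts}" "j \<in> {..<length ts}" "g i = g j"
    then show "i = j"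
      using inj_onD[OF inj, of "[i]" "[j]"] f_single by simp
  qed
  have preimage: "\<exists>j p. j # p \<in> ?T \<and> f (j # p) = k # q" if "k # q \<in> ?U" for k q
  proof -
    have "k # q \<in> f ` ?T"
      unfolding img by (fact that)
    then obtain r where r: "r \<in> ?T" "k # q = f r"
      by (rule imageE)
    then show ?thesis
      using root by (cases r) (simp_all del: vertices.simps, metis)
  qed
  \<comment> \<open>Injectivity of \<open>g\<close> forces the preimage into the subtree at
    \<open>i\<close>, so the restriction to that subtree is onto.\<close>
  have surj: "\<exists>p. i # p \<in> ?T \<and> g i = k \<and> h i p = q"
    if kq: "k # q \<in> ?U" "i < length ts" "g i = k" for i k q
  proof -
    obtain j p where jp: "j # p \<in> ?T" "f (j # p) = k # q"
      using preimage[OF kq(1)] by blast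
    have g: "g j = k" "h j p = q"
      using fh[OF jp(1)] jp(2) by simp_all
    have "j < length ts"
      using jp(1) by simp
    then have "j = i"
      using inj_onD[OF inj_g, of j i] kq(2,3) g by simp
    then show ?thesis
      using jp g by blast
  qed
  have "bij_betw g {..<length ts} {..<length us}"
    unfolding bij_betw_def
  proof (intro conjI inj_g equalityI subsetI)
    fix k assume "k \<in> {..<length us}"
    then have "[k] \<in> ?U"
      by simp
    then obtain j p where jp: "j # p \<in> ?T" "f (j # p) = [k]"
      using preimage by blast
    then show "k \<in> g ` {..<length ts}"
      using fh[OF jp(1)] by auto
  qed (use g_less in auto)
  moreover have "isomorphic (Some (ts ! i)) (Some (us ! g i))" if i: "i < length ts" for i
    unfolding isomorphic_def
  proof (intro exI[of _ "h i"] conjI ballI impI)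
    have v: "i # p \<in> ?T" if "p \<in> vertices (Some (ts ! i))" for p
      using that i by simp
    show "bij_betw (h i) (vertices (Some (ts ! i))) (vertices (Some (us ! g i)))"
      unfolding bij_betw_def
    proof (intro conjI inj_onI equalityI subsetI)
      fix p q assume pq: "p \<in> vertices (Some (ts ! i))" "q \<in> vertices (Some (ts ! i))" "h i p = h i q"
      then have "f (i # p) = f (i # q)"
        using fh v by simp
      then show "p = q"
        using inj_onD[OF inj] v pq by blast
    next
      fix q assume "q \<in> h i ` vertices (Some (ts ! i))"
      then obtain p where p: "p \<in> vertices (Some (ts ! i))" "q = h i p"
        by blast
      then have "f (i # p) \<in> ?U"
        using v img by blast
      then show "q \<in> vertices (Some (us ! g i))"
        using fh v p by simp
    next
      fix q assume "q \<in> vertices (Some (us ! g i))"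
      then have "g i # q \<in> ?U"
        using g_less[OF i] by simp
      then show "q \<in> h i ` vertices (Some (ts ! i))"
        using surj[OF _ i] by fastforce
    qed
    show "h i [] = []"
      using h_Nil i .
    show "adjacent p q \<longleftrightarrow> adjacent (h i p) (h i q)"
      if "p \<in> vertices (Some (ts ! i))" "q \<in> vertices (Some (ts ! i))" for p q
    proof -
      have "adjacent p q \<longleftrightarrow> adjacent (i # p) (i # q)" for p q and i :: nat
        by (auto simp: adjacent_def)
      then show ?thesis
        using f(3) v[OF that(1)] v[OF that(2)] fh by (metis (no_types, lifting))
    qed
  qed
  ultimately show ?thesis
    by blast
qed

section \<open>Leaf counts of suppressed and spanned trees\<close>

lemma num_leaves_suppress: "num_leaves (Some (suppress t)) = num_leaves (Some t)"
proof (induction t rule: suppress.induct)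
  case (1 t)
  then show ?case
    by (simp add: num_leaves_Node)
next
  case ("2_2" x y zs)
  let ?ts = "x # y # zs"
  have "num_leaves (Some (suppress (?ts ! i))) = num_leaves (Some (?ts ! i))" if "i < length ?ts" for i
    using "2_2" nth_mem[OF that] by blast
  then show ?case
    by (simp del: upt_Suc nth_Cons_0 add: num_leaves_Node flip: list.map)
qed auto

lemma spanned_Node_eq:
  "spanned S (Node ts) = Node (map (\<lambda>i. spanned {p. i # p \<in> S} (ts ! i))
     (filter (\<lambda>i. {p. i # p \<in> S} \<noteq> {}) [0..<length ts]))"
  by (simp)

declare spanned.simps[simp del]

lemma filter_upt_eq: "i < n \<Longrightarrow> filter (\<lambda>j. j = i) [0..<n] = [i]"
  by (induction n) (auto simp: filter_empty_conv less_Suc_eq)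

lemma subset_leaves_fibre:
  assumes "S \<subseteq> leaves (Some (Node ts))" "i < length ts"
  shows "{p. i # p \<in> S} \<subseteq> leaves (Some (ts ! i))"
  using assms by (auto simp: Cons_in_leaves)

text \<open>A single vertex is excluded because its only leaf is the empty path, which lies in no
  fibre.\<close>

lemma card_fibres:
  assumes "S \<subseteq> leaves (Some (Node ts))" "ts \<noteq> []"
  shows "card S = (\<Sum>i<length ts. card {p. i # p \<in> S})"
proof -
  have S: "S = (\<Union>i<length ts. (#) i ` {p. i # p \<in> S})"
  proof (rule set_eqI)
    fix p
    show "p \<in> S \<longleftrightarrow> p \<in> (\<Union>i<length ts. (#) i ` {p. i # p \<in> S})"
    proof (cases p)
      case Nil
      then show ?thesis
        using assms Nil_in_leaves by auto
    next
      case (Cons i q)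
      then show ?thesis
        using subsetD[OF assms(1), of p] by (auto simp: Cons_in_leaves)
    qed
  qed
  have "finite {p. i # p \<in> S}" if "i < length ts" for i
    using subset_leaves_fibre[OF assms(1) that] finite_leaves finite_subset by blast
  then have "card (\<Union>i<length ts. (#) i ` {p. i # p \<in> S}) = (\<Sum>i<length ts. card {p. i # p \<in> S})"
    by (subst card_UN_disjoint) (auto simp: card_image)
  then show ?thesis
    using S by simp
qed

text \<open>Nonemptiness matters: \<open>spanned {} t\<close> is a single vertex and has one leaf.
  The filter passes on only branches with nonempty fibre, so the induction never meets that
  case.\<close>

lemma num_leaves_spanned:
  "S \<subseteq> leaves (Some t) \<Longrightarrow> S \<noteq> {} \<Longrightarrow> num_leaves (Some (spanned S t)) = card S"
proof (induction t arbitrary: S)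
  case (Node ts)
  let ?F = "\<lambda>i. {p. i # p \<in> S}"
  let ?is = "filter (\<lambda>i. ?F i \<noteq> {}) [0..<length ts]"
  show ?case
  proof (cases "ts = []")
    case True
    then have "S = {[]}"
      using Node.prems by (auto simp: leaves_leaf)
    then show ?thesis
      using True by (simp add: spanned_Node_eq num_leaves_leaf)
  next
    case False
    have sub: "?F i \<subseteq> leaves (Some (ts ! i))" if "i < length ts" for i
      using subset_leaves_fibre[OF Node.prems(1) that] .
    obtain x where x: "x \<in> S"
      using Node.prems by blast
    then obtain i p where "x = i # p" "i < length ts"
      using Node.prems(1) False by (auto simp: leaves_Node)
    then have "i \<in> set ?is"
      using x by auto
    then have "?is \<noteq> []"
      by (metis empty_iff empty_set)
    then have "num_leaves (Some (spanned S (Node ts)))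
        = (\<Sum>j<length ?is. num_leaves (Some (spanned (?F (?is ! j)) (ts ! (?is ! j)))))"
      unfolding spanned_Node_eq by (subst num_leaves_Node) simp_all
    also have "\<dots> = (\<Sum>i\<in>set ?is. num_leaves (Some (spanned (?F i) (ts ! i))))"
      by (simp only: sum.list_conv_set_nth[symmetric] sum_list_distinct_conv_sum_set[symmetric]
          sum_list_sum_nth atLeast0LessThan length_map distinct_filter distinct_upt)
         simp
    also have "\<dots> = (\<Sum>i\<in>set ?is. card (?F i))"
      using Node.IH sub by (intro sum.cong) auto
    also have "\<dots> = (\<Sum>i<length ts. card (?F i))"
      by (rule sum.mono_neutral_left) (auto simp: card_gt_0_iff)
    finally show ?thesis
      using card_fibres[OF Node.prems(1) False] by simp
  qed
qed

lemma num_leaves_induced: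
  assumes "S \<subseteq> leaves T"
  shows "num_leaves (induced S T) = card S"
proof (cases "S = {}")
  case False
  then obtain t where "T = Some t"
    using assms by (cases T) (auto simp: leaves_None)
  then show ?thesis
    using False assms by (simp add: induced_def num_leaves_suppress num_leaves_spanned)
qed (simp add: induced_def num_leaves_None)

text \<open>One leaf spans a path, and suppression collapses a path to its end.\<close>

lemma suppress_spanned_singleton:
  "p \<in> leaves (Some t) \<Longrightarrow> suppress (spanned {p} t) = Node []"
proof (induction t arbitrary: p)
  case (Node ts)
  show ?case
  proof (cases p)
    case Nil
    then have "ts = []"
      using Node.prems Nil_in_leaves by simp
    then show ?thesis
      by (simp add: spanned_Node_eq)
  next
    case (Cons i q)
    then have i: "i < length ts" "q \<in> leaves (Some (ts ! i))"
      using Node.prems by (auto simp: Cons_in_leaves)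
    have "filter (\<lambda>j. {r. j # r \<in> {p}} \<noteq> {}) [0..<length ts] = filter (\<lambda>j. j = i) [0..<length ts]"
      using Cons by (intro filter_cong) auto
    also have "\<dots> = [i]"
      using i by (simp add: filter_upt_eq)
    finally have "spanned {p} (Node ts) = Node [spanned {q} (ts ! i)]"
      unfolding spanned_Node_eq using Cons by simp
    then show ?thesis
      using Node.IH[OF nth_mem] i by simp
  qed
qed

section \<open>The recursion for the number of copies\<close>

lemma branch_Node:
  "i < d \<Longrightarrow> length ts \<le> d \<Longrightarrow>
     branch d (Node ts) i = (if i < length ts then Some (ts ! i) else None)"
  by (simp add: branch_def nth_append)

lemma dary_branch:
  assumes "dary d t" "i < d"
  shows "dary_tree d (branch d t i)"
proof (cases t)
  case (Node ts)
  then show ?thesis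
    using assms branch_Node[of i d ts] by auto
qed

lemma num_leaves_branches:
  assumes "dary d (Node ts)" "ts \<noteq> []"
  shows "num_leaves (Some (Node ts)) = (\<Sum>i<d. num_leaves (branch d (Node ts) i))"
proof -
  have len: "length ts \<le> d"
    using assms by auto
  have "(\<Sum>i<d. num_leaves (branch d (Node ts) i)) = (\<Sum>i<length ts. num_leaves (branch d (Node ts) i))"
    using len by (intro sum.mono_neutral_right) (auto simp: branch_Node num_leaves_None)
  then show ?thesis
    using assms len by (simp add: num_leaves_Node branch_Node)
qed

definition copy_sets :: "rtree option \<Rightarrow> rtree option \<Rightarrow> nat list set set" where
  "copy_sets D T = {S. S \<subseteq> leaves T \<and> card S = num_leaves D \<and> isomorphic (induced S T) D}"

lemma copies_eq: "copies D T = card (copy_sets D T)"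
  by (simp add: copies_def copy_sets_def)

lemma finite_copy_sets: "finite (copy_sets D T)"
  by (rule finite_subset[of _ "Pow (leaves T)"]) (auto simp: copy_sets_def finite_leaves)

text \<open>The cardinality demanded by \<open>copy_sets\<close> is automatic: the induced tree has
  \<open>card S\<close> leaves, and isomorphisms preserve leaf counts.\<close>

lemma copy_setsI:
  "S \<subseteq> leaves T \<Longrightarrow> isomorphic (induced S T) D \<Longrightarrow> S \<in> copy_sets D T"
  by (metis (mono_tags, lifting) copy_sets_def isomorphic_num_leaves mem_Collect_eq num_leaves_induced)

lemma copies_le_binomial: "copies D T \<le> num_leaves T choose num_leaves D"
proof -
  have "copies D T \<le> card {S. S \<subseteq> leaves T \<and> card S = num_leaves D}"
    unfolding copies_eq by (intro card_mono) (auto simp: copy_sets_def finite_leaves)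
  then show ?thesis
    by (simp add: n_subsets finite_leaves num_leaves_def)
qed

lemma copies_leaf: "copies (Some (Node [])) T = num_leaves T"
proof -
  have "copy_sets (Some (Node [])) T = (\<lambda>p. {p}) ` leaves T"
  proof (intro equalityI subsetI)
    fix S assume "S \<in> copy_sets (Some (Node [])) T"
    then show "S \<in> (\<lambda>p. {p}) ` leaves T"
      by (auto simp: copy_sets_def num_leaves_leaf card_1_singleton_iff)
  next
    fix S assume "S \<in> (\<lambda>p. {p}) ` leaves T"
    then obtain p where p: "p \<in> leaves T" "S = {p}"
      by blast
    then obtain t where "T = Some t"
      by (cases T) (auto simp: leaves_None)
    then have "induced S T = Some (Node [])"
      using p by (simp add: induced_def suppress_spanned_singleton)
    then show "S \<in> copy_sets (Some (Node [])) T"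
      using p by (intro copy_setsI) (auto simp: isomorphic_refl)
  qed
  then show ?thesis
    by (simp add: copies_eq card_image num_leaves_def)
qed

section \<open>Copies inside one branch and copies at the root\<close>

lemma suppress_Node_not_singleton:
  "length ts \<noteq> 1 \<Longrightarrow> suppress (Node ts) = Node (map suppress ts)"
  by (cases ts rule: list.exhaust; cases "tl ts" rule: list.exhaust) auto

text \<open>Equally many indices remain on both sides and can be matched arbitrarily. In the
  application \<open>I\<close> and \<open>J\<close> index nonempty branches, so the remaining ones
  pair empty branches with each other.\<close>

lemma bij_betw_extend_permutes:
  assumes "finite A" "I \<subseteq> A" "J \<subseteq> A" "bij_betw e I J"
  obtains \<pi> where "\<pi> permutes A" "\<And>x. x \<in> I \<Longrightarrow> \<pi> x = e x" "\<And>x. x \<in> A - I \<Longrightarrow> \<pi> x \<in> A - J"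
proof -
  have "card (A - I) = card (A - J)"
    using assms bij_betw_same_card[OF assms(4)] by (simp add: card_Diff_subset finite_subset)
  then obtain h where h: "bij_betw h (A - I) (A - J)"
    using assms(1) finite_same_card_bij by (metis finite_Diff)
  define \<pi> where "\<pi> x = (if x \<in> I then e x else if x \<in> A then h x else x)" for x
  have "bij_betw \<pi> I J"
    using assms(4) by (rule bij_betw_cong[THEN iffD1, rotated]) (simp add: \<pi>_def)
  moreover have "bij_betw \<pi> (A - I) (A - J)"
    using h by (rule bij_betw_cong[THEN iffD1, rotated]) (simp add: \<pi>_def)
  ultimately have "bij_betw \<pi> (I \<union> (A - I)) (J \<union> (A - J))"
    by (rule bij_betw_combine) auto
  then have "bij_betw \<pi> A A"
    using assms(2,3) by (simp add: Un_absorb1)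
  then have "\<pi> permutes A"
    using assms(2) by (intro bij_imp_permutes) (auto simp: \<pi>_def)
  moreover have "\<pi> x \<in> A - J" if "x \<in> A - I" for x
    using bij_betwE[OF h] that by (simp add: \<pi>_def)
  ultimately show ?thesis
    using that by (simp add: \<pi>_def)
qed

text \<open>The spanned tree has a root with one child, which suppression removes.\<close>

lemma induced_Node_single:
  assumes "S \<subseteq> leaves (Some (Node ts))" "{i. {p. i # p \<in> S} \<noteq> {}} = {j}" "j < length ts"
  shows "induced S (Some (Node ts)) = induced {p. j # p \<in> S} (Some (ts ! j))"
proof -
  have "filter (\<lambda>i. {p. i # p \<in> S} \<noteq> {}) [0..<length ts] = filter (\<lambda>i. i = j) [0..<length ts]"
    using assms(2) by (intro filter_cong) auto
  also have "\<dots> = [j]"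
    using assms(3) by (simp add: filter_upt_eq)
  finally have "spanned S (Node ts) = Node [spanned {p. j # p \<in> S} (ts ! j)]"
    unfolding spanned_Node_eq by simp
  moreover have "{p. j # p \<in> S} \<noteq> {}" "S \<noteq> {}"
    using assms(2) by blast+
  ultimately show ?thesis
    by (simp add: induced_def)
qed

text \<open>The root of the spanned tree survives suppression. Every branch in the filtered list has
  a nonempty fibre, so \<open>the\<close> is never applied to the empty tree.\<close>

lemma induced_Node_multiple:
  assumes "S \<noteq> {}" "length (filter (\<lambda>i. {p. i # p \<in> S} \<noteq> {}) [0..<length ts]) \<noteq> 1"
  shows "induced S (Some (Node ts)) =
    Some (Node (map (\<lambda>i. the (induced {p. i # p \<in> S} (Some (ts ! i))))
      (filter (\<lambda>i. {p. i # p \<in> S} \<noteq> {}) [0..<length ts])))"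
  using assms by (simp add: induced_def spanned_Node_eq suppress_Node_not_singleton)

text \<open>The isomorphism matches the branches met by \<open>S\<close> with the nonempty branches
  of \<open>Node ds\<close>. Padding both sides to \<open>d\<close> entries turns this matching into
  a permutation in which \<open>None\<close> meets \<open>None\<close>.\<close>

lemma isomorphic_induced_branches:
  assumes S: "S \<subseteq> leaves (Some (Node ts))" "S \<noteq> {}"
    and len: "length (filter (\<lambda>i. {p. i # p \<in> S} \<noteq> {}) [0..<length ts]) \<noteq> 1"
    and ts: "length ts \<le> d" and ds: "length ds \<le> d"
    and iso: "isomorphic (induced S (Some (Node ts))) (Some (Node ds))"
  obtains \<pi> where "\<pi> permutes {..<d}"
    "\<And>j. j < d \<Longrightarrow>
       isomorphic (induced {p. j # p \<in> S} (branch d (Node ts) j)) (branch d (Node ds) (\<pi> j))"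
proof -
  let ?F = "\<lambda>i. {p. i # p \<in> S}"
  define js where "js = filter (\<lambda>i. ?F i \<noteq> {}) [0..<length ts]"
  obtain g where g: "bij_betw g {..<length js} {..<length ds}"
    "\<forall>i<length js. isomorphic (Some (the (induced (?F (js ! i)) (Some (ts ! (js ! i)))))) (Some (ds ! g i))"
    using isomorphic_Node_children[OF iso[unfolded induced_Node_multiple[OF S(2) len]]]
    by (auto simp: js_def)
  have js: "bij_betw ((!) js) {..<length js} (set js)"
    by (rule bij_betw_nth) (auto simp: js_def)
  \<comment> \<open>\<open>g\<close> acts on positions in the filtered list \<open>js\<close>;
    \<open>pos\<close> translates branch numbers into such positions.\<close>
  define pos where "pos = the_inv_into {..<length js} ((!) js)"
  have pos: "bij_betw pos (set js) {..<length js}"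
    unfolding pos_def by (rule bij_betw_the_inv_into[OF js])
  have js_pos: "js ! pos j = j" if "j \<in> set js" for j
    unfolding pos_def using js that by (meson f_the_inv_into_f_bij_betw)
  have sub: "set js \<subseteq> {..<d}" "{..<length ds} \<subseteq> {..<d}"
    using ts ds by (auto simp: js_def)
  obtain \<pi> where \<pi>: "\<pi> permutes {..<d}" "\<And>x. x \<in> set js \<Longrightarrow> \<pi> x = (g \<circ> pos) x"
    "\<And>x. x \<in> {..<d} - set js \<Longrightarrow> \<pi> x \<in> {..<d} - {..<length ds}"
    using bij_betw_extend_permutes[OF finite_lessThan sub bij_betw_trans[OF pos g(1)]] by metis
  have "isomorphic (induced (?F j) (branch d (Node ts) j)) (branch d (Node ds) (\<pi> j))"
    if "j < d" for j
  proof (cases "j \<in> set js")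
    case True
    then have j: "?F j \<noteq> {}" "j < length ts"
      by (auto simp: js_def)
    have "pos j < length js"
      using bij_betwE[OF pos] True by blast
    moreover from this have "g (pos j) < length ds"
      using bij_betwE[OF g(1)] by blast
    ultimately have "isomorphic (Some (the (induced (?F j) (Some (ts ! j))))) (branch d (Node ds) (\<pi> j))"
      using g(2) js_pos[OF True] \<pi>(2)[OF True] ds by (simp add: branch_Node) metis
    moreover have "Some (the (induced (?F j) (Some (ts ! j)))) = induced (?F j) (Some (ts ! j))"
      using j(1) by (simp add: induced_def)
    ultimately show ?thesis
      using j(2) ts that by (simp add: branch_Node)
  next
    case False
    have "?F j = {}"
    proof (cases "j < length ts")
      case True
      then show ?thesis
        using False by (auto simp: js_def)
    next
      case False
      then show ?thesis
        using S(1) by (auto simp: Cons_in_leaves)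
    qed
    moreover have "branch d (Node ds) (\<pi> j) = None"
      using \<pi>(3)[of j] False that ds by (auto simp: branch_Node)
    ultimately show ?thesis
      by (simp add: induced_def isomorphic_refl)
  qed
  then show ?thesis
    using that \<pi>(1) by blast
qed

text \<open>A union bound: every copy is the image of a copy in one branch, or is glued from its
  fibres, which are copies of the branches in the order given by some element of
  \<open>M\<close>.\<close>

lemma copies_recursion:
  assumes ds: "length ds \<le> d" "ds \<noteq> []" and ts: "length ts \<le> d" "ts \<noteq> []"
    and M: "representatives d (Node ds) M"
  shows "copies (Some (Node ds)) (Some (Node ts)) \<le>
    (\<Sum>j<d. copies (Some (Node ds)) (branch d (Node ts) j)) +
    (\<Sum>\<rho>\<in>M. \<Prod>j<d. copies (branch d (Node ds) (\<rho> j)) (branch d (Node ts) j))"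
proof -
  let ?D = "Node ds" and ?T = "Node ts"
  let ?B = "\<lambda>j. branch d ?T j"
  let ?X = "\<lambda>\<rho>. Pi\<^sub>E {..<d} (\<lambda>j. copy_sets (branch d ?D (\<rho> j)) (?B j))"
  have finM: "finite M"
    using M by (auto simp: representatives_def intro: finite_subset[OF _ finite_permutations])
  have finX: "finite (?X \<rho>)" for \<rho>
    by (intro finite_PiE finite_lessThan finite_copy_sets)
  have sub: "copy_sets (Some ?D) (Some ?T) \<subseteq>
      (\<Union>j<d. (`) ((#) j) ` copy_sets (Some ?D) (?B j)) \<union>
      (\<Union>\<rho>\<in>M. (\<lambda>s. \<Union>j<d. (#) j ` s j) ` ?X \<rho>)"
  proof
    fix S assume S: "S \<in> copy_sets (Some ?D) (Some ?T)"
    let ?F = "\<lambda>i. {p. i # p \<in> S}"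
    have SL: "S \<subseteq> leaves (Some ?T)" and iso: "isomorphic (induced S (Some ?T)) (Some ?D)"
      using S by (auto simp: copy_sets_def)
    have "S \<noteq> {}"
      using iso by (auto simp: induced_def isomorphic_None_iff)
    have F: "?F j \<subseteq> leaves (?B j)" if "j < d" for j
      using SL that ts by (auto simp: Cons_in_leaves branch_Node)
    have F0: "j < length ts" if "j # q \<in> S" for j q
      using SL that by (auto simp: Cons_in_leaves)
    have S_eq: "S = (\<Union>j<d. (#) j ` ?F j)"
    proof (rule set_eqI)
      fix p
      show "p \<in> S \<longleftrightarrow> p \<in> (\<Union>j<d. (#) j ` ?F j)"
      proof (cases p)
        case Nil
        then show ?thesis
          using SL ts Nil_in_leaves by auto
      next
        case (Cons i q)
        have "p \<in> S \<longleftrightarrow> i < d \<and> q \<in> ?F i"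
          using Cons F0[of i q] ts by auto
        then show ?thesis
          using Cons by auto
      qed
    qed
    show "S \<in> (\<Union>j<d. (`) ((#) j) ` copy_sets (Some ?D) (?B j)) \<union>
      (\<Union>\<rho>\<in>M. (\<lambda>s. \<Union>j<d. (#) j ` s j) ` ?X \<rho>)"
    proof (cases "length (filter (\<lambda>i. ?F i \<noteq> {}) [0..<length ts]) = 1")
      case True
      define js where "js = filter (\<lambda>i. ?F i \<noteq> {}) [0..<length ts]"
      have "length js = 1"
        using True unfolding js_def .
      then obtain j where "js = [j]"
        by (cases js) auto
      moreover have "set js = {i. ?F i \<noteq> {}}"
        using F0 by (auto simp: js_def)
      moreover have "set js \<subseteq> {..<length ts}"
        by (auto simp: js_def)
      ultimately have "{i. ?F i \<noteq> {}} = {j}" "{j} \<subseteq> {..<length ts}"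
        by simp_all
      then have j: "{i. ?F i \<noteq> {}} = {j}" "j < length ts"
        by simp_all
      then have "isomorphic (induced (?F j) (?B j)) (Some ?D)"
        using iso induced_Node_single[OF SL j] ts by (simp add: branch_Node)
      then have "?F j \<in> copy_sets (Some ?D) (?B j)"
        using F j(2) ts by (intro copy_setsI) auto
      moreover have "S = (#) j ` ?F j"
      proof (intro equalityI subsetI)
        fix p assume p: "p \<in> S"
        then obtain i q where iq: "p = i # q"
          using SL ts Nil_in_leaves by (cases p) auto
        then have "i \<in> {i. ?F i \<noteq> {}}"
          using p by blast
        then show "p \<in> (#) j ` ?F j"
          unfolding j(1) using iq p by simp
      qed auto
      ultimately show ?thesis
        using j(2) ts by (intro UnI1 UN_I[of j]) auto
    next
      case False
      obtain \<pi> where \<pi>: "\<pi> permutes {..<d}"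
        "\<And>j. j < d \<Longrightarrow> isomorphic (induced (?F j) (?B j)) (branch d ?D (\<pi> j))"
        using isomorphic_induced_branches[OF SL \<open>S \<noteq> {}\<close> False ts(1) ds(1) iso] by blast
      \<comment> \<open>Passing from \<open>\<pi>\<close> to its representative changes each target
        branch only up to isomorphism, so the fibres remain copies.\<close>
      obtain \<rho> where \<rho>: "\<rho> \<in> M" "perm_equiv d ?D \<pi> \<rho>"
        using M \<pi>(1) unfolding representatives_def by blast
      have "?F j \<in> copy_sets (branch d ?D (\<rho> j)) (?B j)" if "j < d" for j
        using F[OF that] \<pi>(2)[OF that] \<rho>(2) that isomorphic_trans
        by (intro copy_setsI) (auto simp: perm_equiv_def)
      then have "restrict ?F {..<d} \<in> ?X \<rho>"
        by auto
      moreover have "S = (\<Union>j<d. (#) j ` restrict ?F {..<d} j)"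
        by (subst S_eq) simp
      ultimately show ?thesis
        using \<rho>(1) by blast
    qed
  qed
  have "copies (Some ?D) (Some ?T) \<le>
      card ((\<Union>j<d. (`) ((#) j) ` copy_sets (Some ?D) (?B j)) \<union>
      (\<Union>\<rho>\<in>M. (\<lambda>s. \<Union>j<d. (#) j ` s j) ` ?X \<rho>))"
    unfolding copies_eq using finM finX finite_copy_sets by (intro card_mono sub) auto
  also have "\<dots> \<le> card (\<Union>j<d. (`) ((#) j) ` copy_sets (Some ?D) (?B j)) +
      card (\<Union>\<rho>\<in>M. (\<lambda>s. \<Union>j<d. (#) j ` s j) ` ?X \<rho>)"
    by (rule card_Un_le)
  also have "\<dots> \<le> (\<Sum>j<d. card ((`) ((#) j) ` copy_sets (Some ?D) (?B j))) +
      (\<Sum>\<rho>\<in>M. card ((\<lambda>s. \<Union>j<d. (#) j ` s j) ` ?X \<rho>))"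
    using finM by (intro add_mono card_UN_le) auto
  also have "\<dots> \<le> (\<Sum>j<d. copies (Some ?D) (?B j)) + (\<Sum>\<rho>\<in>M. card (?X \<rho>))"
    unfolding copies_eq by (intro add_mono sum_mono card_image_le finX finite_copy_sets)
  finally show ?thesis
    by (simp add: card_PiE copies_eq)
qed

section \<open>Counting permutations and leaf sets\<close>

text \<open>A Vandermonde-type count. In a disjoint union of blocks of sizes \<open>n j\<close>, the
  product counts the sets that meet block \<open>j\<close> in \<open>a j\<close> elements, and such
  a set determines \<open>a\<close> on \<open>J\<close>. Extensionality makes vectors that agree on
  \<open>J\<close> equal.\<close>

lemma sum_prod_binomial_le:
  fixes n :: "'a \<Rightarrow> nat"
  assumes "finite J" "finite A" and ext: "A \<subseteq> extensional J" and sum: "\<And>a. a \<in> A \<Longrightarrow> sum a J = k"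
  shows "(\<Sum>a\<in>A. \<Prod>j\<in>J. n j choose a j) \<le> sum n J choose k"
proof -
  define X where "X a = Pi\<^sub>E J (\<lambda>j. {s. s \<subseteq> {..<n j} \<and> card s = a j})" for a
  let ?U = "Sigma J (\<lambda>j. {..<n j})"
  have finX: "finite (X a)" for a
    unfolding X_def using assms(1) by (intro finite_PiE) auto
  have fibre: "Sigma J s `` {j} = s j" if "j \<in> J" for s :: "'a \<Rightarrow> nat set" and j
    using that by auto
  have inj: "inj_on (Sigma J) (X a)" for a
  proof (rule inj_onI)
    fix s t assume st: "s \<in> X a" "t \<in> X a" and eq: "Sigma J s = Sigma J t"
    have "s j = t j" if "j \<in> J" for j
      using fibre[OF that, of s] fibre[OF that, of t] eq by simp
    then show "s = t"
      by (rule PiE_ext[OF st[unfolded X_def]])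
  qed
  have "(\<Sum>a\<in>A. \<Prod>j\<in>J. n j choose a j) = (\<Sum>a\<in>A. card (Sigma J ` X a))"
    unfolding card_image[OF inj] using assms(1) by (simp add: X_def card_PiE n_subsets)
  also have "\<dots> = card (\<Union>a\<in>A. Sigma J ` X a)"
  proof (rule card_UN_disjoint[symmetric])
    show "\<forall>a\<in>A. \<forall>b\<in>A. a \<noteq> b \<longrightarrow> Sigma J ` X a \<inter> Sigma J ` X b = {}"
    proof (intro ballI impI equals0I)
      fix a b S assume ab: "a \<in> A" "b \<in> A" "a \<noteq> b" and "S \<in> Sigma J ` X a \<inter> Sigma J ` X b"
      then obtain s t where st: "s \<in> X a" "t \<in> X b" "Sigma J s = Sigma J t"
        by auto
      have "a j = b j" if "j \<in> J" for j
      proof -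
        have "s j = t j"
          using st(3) fibre[OF that, of s] fibre[OF that, of t] by simp
        moreover have "card (s j) = a j" "card (t j) = b j"
          using st(1,2) that by (auto simp: X_def PiE_iff)
        ultimately show ?thesis
          by simp
      qed
      then have "a = b"
        using ext ab by (intro extensionalityI[of a J b]) auto
      then show False
        using ab by simp
    qed
  qed (use assms(2) finX in auto)
  also have "\<dots> \<le> card {S. S \<subseteq> ?U \<and> card S = k}"
  proof (intro card_mono subsetI)
    show "finite {S. S \<subseteq> ?U \<and> card S = k}"
    proof (rule finite_subset[of _ "Pow ?U"])
      show "finite (Pow ?U)"
        using assms(1) by auto
    qed auto
  next
    fix S assume "S \<in> (\<Union>a\<in>A. Sigma J ` X a)"
    then obtain a s where as: "a \<in> A" "s \<in> X a" "S = Sigma J s"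
      by blast
    have s: "s j \<subseteq> {..<n j}" "card (s j) = a j" if "j \<in> J" for j
      using as(2) that by (auto simp: X_def PiE_iff)
    then have "card S = (\<Sum>j\<in>J. card (s j))"
      using assms(1) as(3) by (simp add: card_SigmaI finite_subset[OF s(1)])
    also have "\<dots> = k"
      using s(2) sum[OF as(1)] by simp
    finally show "S \<in> {S. S \<subseteq> ?U \<and> card S = k}"
      using s(1) as(3) by auto
  qed
  also have "\<dots> = sum n J choose k"
    using assms(1) by (subst n_subsets) (auto simp: card_SigmaI)
  finally show ?thesis .
qed

text \<open>Turns a sum over an arbitrary choice of representatives into a sum over the whole set,
  which can then be regrouped by another criterion. Unique representatives make the classes a
  partition.\<close>

lemma sum_over_representatives:
  fixes F :: "'a \<Rightarrow> real"
  assumes "finite G" "M \<subseteq> G"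
    and ex1: "\<And>x. x \<in> G \<Longrightarrow> \<exists>!y. y \<in> M \<and> E x y"
    and card: "\<And>y. y \<in> M \<Longrightarrow> card {x \<in> G. E x y} = s"
    and F: "\<And>x y. x \<in> G \<Longrightarrow> y \<in> M \<Longrightarrow> E x y \<Longrightarrow> F x = F y"
  shows "sum F G = real s * sum F M"
proof -
  have G: "G = (\<Union>y\<in>M. {x \<in> G. E x y})"
    using ex1 by blast
  have "sum F G = sum F (\<Union>y\<in>M. {x \<in> G. E x y})"
    by (rule arg_cong[OF G])
  also have "\<dots> = (\<Sum>y\<in>M. sum F {x \<in> G. E x y})"
  proof (rule sum.UNION_disjoint)
    show "finite M"
      using assms(1,2) by (rule finite_subset[rotated])
    show "\<forall>y\<in>M. \<forall>z\<in>M. y \<noteq> z \<longrightarrow> {x \<in> G. E x y} \<inter> {x \<in> G. E x z} = {}"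
      using ex1 by blast
  qed (use assms(1) in simp)
  also have "\<dots> = (\<Sum>y\<in>M. \<Sum>x\<in>{x \<in> G. E x y}. F y)"
    using F by (intro sum.cong refl) auto
  also have "\<dots> = (\<Sum>y\<in>M. real s * F y)"
    using card by (intro sum.cong refl) simp
  finally show ?thesis
    by (simp add: sum_distrib_left)
qed

text \<open>\<open>R\<close> is a parameter because two groups are compared: the one preserving
  branches up to isomorphism and the one preserving their leaf counts.\<close>

abbreviation (input) symmetries :: "nat \<Rightarrow> (nat \<Rightarrow> nat \<Rightarrow> bool) \<Rightarrow> (nat \<Rightarrow> nat) set" where
  "symmetries d R \<equiv> {h. h permutes {..<d} \<and> (\<forall>i<d. R (h i) i)}"

text \<open>The class of \<open>\<rho>\<close> is the right coset of the symmetry group, so all classes have the same size.\<close>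

lemma card_permutation_class:
  assumes "\<rho> permutes {..<d}"
  shows "card {\<pi>. \<pi> permutes {..<d} \<and> (\<forall>j<d. R (\<pi> j) (\<rho> j))} = card (symmetries d R)"
proof -
  have "{\<pi>. \<pi> permutes {..<d} \<and> (\<forall>j<d. R (\<pi> j) (\<rho> j))} = (\<lambda>h. h \<circ> \<rho>) ` symmetries d R"
  proof (intro equalityI subsetI)
    fix \<pi> assume \<pi>: "\<pi> \<in> {\<pi>. \<pi> permutes {..<d} \<and> (\<forall>j<d. R (\<pi> j) (\<rho> j))}"
    define h where "h = \<pi> \<circ> inv \<rho>"
    have "\<pi> = h \<circ> \<rho>"
      using permutes_inv_o(2)[OF assms] by (simp add: h_def comp_assoc)
    moreover have "h permutes {..<d}"
      unfolding h_def using \<pi> permutes_compose[OF permutes_inv[OF assms]] by blast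
    moreover have "R (h i) i" if "i < d" for i
    proof -
      have "inv \<rho> i < d"
        using permutes_in_image[OF permutes_inv[OF assms], of i] that by simp
      then have "R (\<pi> (inv \<rho> i)) (\<rho> (inv \<rho> i))"
        using \<pi> by blast
      then show ?thesis
        by (simp add: h_def permutes_inverses[OF assms])
    qed
    ultimately show "\<pi> \<in> (\<lambda>h. h \<circ> \<rho>) ` symmetries d R"
      by blast
  next
    fix \<pi> assume "\<pi> \<in> (\<lambda>h. h \<circ> \<rho>) ` symmetries d R"
    then obtain h where h: "h permutes {..<d}" "\<forall>i<d. R (h i) i" "\<pi> = h \<circ> \<rho>"
      by blast
    then show "\<pi> \<in> {\<pi>. \<pi> permutes {..<d} \<and> (\<forall>j<d. R (\<pi> j) (\<rho> j))}"
      using permutes_compose[OF assms h(1)] permutes_in_image[OF assms] by simp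
  qed
  moreover have "inj_on (\<lambda>h. h \<circ> \<rho>) (symmetries d R)"
  proof (rule inj_onI)
    fix h h' assume "h \<circ> \<rho> = h' \<circ> \<rho>"
    then have "(h \<circ> \<rho>) \<circ> inv \<rho> = (h' \<circ> \<rho>) \<circ> inv \<rho>"
      by simp
    then show "h = h'"
      using permutes_inv_o(1)[OF assms] by (simp add: comp_assoc)
  qed
  ultimately show ?thesis
    by (simp add: card_image)
qed

text \<open>The distinct rearrangements of the vector \<open>k 0\<close>, ...,
  \<open>k (d - 1)\<close>. The restriction makes vectors that agree below \<open>d\<close> equal as
  functions, so each is listed once.\<close>

definition arrangements :: "nat \<Rightarrow> (nat \<Rightarrow> nat) \<Rightarrow> (nat \<Rightarrow> nat) set" where
  "arrangements d k = (\<lambda>\<pi>. restrict (k \<circ> \<pi>) {..<d}) ` {\<pi>. \<pi> permutes {..<d}}"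

text \<open>Two permutations give the same vector exactly if they lie in one class for equality of
  \<open>k\<close>, and all these classes have the size of the symmetry group.\<close>

lemma sum_permutations_arrangements:
  fixes f :: "(nat \<Rightarrow> nat) \<Rightarrow> real"
  shows "(\<Sum>\<pi> | \<pi> permutes {..<d}. f (restrict (k \<circ> \<pi>) {..<d})) =
    real (card (symmetries d (\<lambda>i j. k i = k j))) * sum f (arrangements d k)"
proof -
  let ?G = "{\<pi>. \<pi> permutes {..<d}}" and ?v = "\<lambda>\<pi>. restrict (k \<circ> \<pi>) {..<d}"
  have fin: "finite ?G"
    by (simp add: finite_permutations)
  have "(\<Sum>\<pi>\<in>?G. f (?v \<pi>)) = (\<Sum>a\<in>?v ` ?G. \<Sum>\<pi>\<in>{\<pi> \<in> ?G. ?v \<pi> = a}. f (?v \<pi>))"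
    by (rule sum.image_gen[OF fin])
  also have "\<dots> = (\<Sum>a\<in>?v ` ?G. real (card (symmetries d (\<lambda>i j. k i = k j))) * f a)"
  proof (rule sum.cong[OF refl])
    fix a assume "a \<in> ?v ` ?G"
    then obtain \<rho> where \<rho>: "\<rho> permutes {..<d}" "a = ?v \<rho>"
      by blast
    have "{\<pi> \<in> ?G. ?v \<pi> = a} = {\<pi>. \<pi> permutes {..<d} \<and> (\<forall>j<d. k (\<pi> j) = k (\<rho> j))}"
      by (auto simp: \<rho>(2) restrict_def fun_eq_iff)
    then have "card {\<pi> \<in> ?G. ?v \<pi> = a} = card (symmetries d (\<lambda>i j. k i = k j))"
      using card_permutation_class[OF \<rho>(1), of "\<lambda>i j. k i = k j"] by simp
    moreover have "(\<Sum>\<pi>\<in>{\<pi> \<in> ?G. ?v \<pi> = a}. f (?v \<pi>)) = (\<Sum>\<pi>\<in>{\<pi> \<in> ?G. ?v \<pi> = a}. f a)"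
      by (intro sum.cong) auto
    ultimately show "(\<Sum>\<pi>\<in>{\<pi> \<in> ?G. ?v \<pi> = a}. f (?v \<pi>)) =
        real (card (symmetries d (\<lambda>i j. k i = k j))) * f a"
      by (simp only: sum_constant)
  qed
  finally show ?thesis
    by (simp add: arrangements_def sum_distrib_left)
qed

text \<open>Closes the recursion for the main term. The vectors that put the whole sum into one
  coordinate account for copies inside a branch; they are no rearrangements of \<open>k\<close>,
  since \<open>k\<close> has two positive entries.\<close>

lemma arrangements_binomial_le:
  fixes n k :: "nat \<Rightarrow> nat"
  assumes d: "2 \<le> d" and k: "k 0 > 0" "k 1 > 0"
  shows "(\<Sum>a\<in>arrangements d k. \<Prod>j<d. n j choose a j) + (\<Sum>i<d. n i choose sum k {..<d})
    \<le> (\<Sum>j<d. n j) choose sum k {..<d}"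
proof -
  let ?s = "sum k {..<d}"
  define e where "e i = (\<lambda>j\<in>{..<d}. if j = i then ?s else 0)" for i
  have s: "?s > 0"
    using d k(1) by (intro sum_pos2[of _ 0]) auto
  have e_inj: "inj_on e {..<d}"
  proof (rule inj_onI)
    fix i i' assume i: "i \<in> {..<d}" "e i = e i'"
    from fun_cong[OF i(2), of i] show "i = i'"
      using i(1) s by (simp add: e_def split: if_splits)
  qed
  have fin: "finite (arrangements d k)"
    by (simp add: arrangements_def finite_permutations)
  have arr: "\<exists>\<pi>. \<pi> permutes {..<d} \<and> a = restrict (k \<circ> \<pi>) {..<d}" if "a \<in> arrangements d k" for a
    using that by (auto simp: arrangements_def)
  \<comment> \<open>Otherwise the positive entries \<open>k 0\<close> and \<open>k 1\<close> would
    both sit at coordinate \<open>i\<close>, against injectivity.\<close>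
  have disj: "e i \<notin> arrangements d k" for i
  proof
    assume "e i \<in> arrangements d k"
    then obtain \<pi> where \<pi>: "\<pi> permutes {..<d}" "e i = restrict (k \<circ> \<pi>) {..<d}"
      using arr by blast
    have "inv \<pi> m = i" if "m < d" "k m > 0" for m
    proof -
      have m: "inv \<pi> m < d"
        using permutes_in_image[OF permutes_inv[OF \<pi>(1)], of m] that(1) by simp
      have "e i (inv \<pi> m) = k m"
        using \<pi> m by (simp add: permutes_inverses)
      then show ?thesis
        using that(2) m by (simp add: e_def split: if_splits)
    qed
    from this[of 0] this[of 1] have "inv \<pi> 0 = inv \<pi> 1"
      using d k by simp
    then show False
      using permutes_inj[OF permutes_inv[OF \<pi>(1)]] by (metis injD zero_neq_one)
  qed
  let ?g = "\<lambda>a. \<Prod>j<d. n j choose a j"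
  have g_e: "?g (e i) = n i choose ?s" if "i < d" for i
  proof -
    have "?g (e i) = (\<Prod>j<d. if j = i then n j choose ?s else 1)"
      by (intro prod.cong) (auto simp: e_def)
    then show ?thesis
      using that by simp
  qed
  have "sum ?g (arrangements d k) + (\<Sum>i<d. n i choose ?s)
      = sum ?g (arrangements d k) + sum ?g (e ` {..<d})"
    using g_e by (simp add: sum.reindex[OF e_inj])
  also have "\<dots> = sum ?g (arrangements d k \<union> e ` {..<d})"
    using fin disj by (intro sum.union_disjoint[symmetric]) auto
  also have "\<dots> \<le> sum n {..<d} choose ?s"
  proof (rule sum_prod_binomial_le)
    show "arrangements d k \<union> e ` {..<d} \<subseteq> extensional {..<d}"
      by (auto simp: arrangements_def e_def)
    fix a assume "a \<in> arrangements d k \<union> e ` {..<d}"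
    then show "sum a {..<d} = ?s"
    proof
      assume "a \<in> arrangements d k"
      then obtain \<pi> where \<pi>: "\<pi> permutes {..<d}" "a = restrict (k \<circ> \<pi>) {..<d}"
        using arr by blast
      then show ?thesis
        using sum.permute[OF \<pi>(1), of k] by simp
    next
      assume "a \<in> e ` {..<d}"
      then show ?thesis
        by (auto simp: e_def)
    qed
  qed (use fin in auto)
  finally show ?thesis .
qed

text \<open>A permutation preserving \<open>k\<close> permutes each level set of \<open>k\<close>
  and is determined by its restrictions to them.\<close>

lemma card_symmetries_le:
  fixes k :: "nat \<Rightarrow> nat"
  shows "card (symmetries d (\<lambda>i j. k i = k j)) \<le> (\<Prod>v\<in>k ` {..<d}. fact (card {i. i < d \<and> k i = v}))"
proof -
  let ?A = "\<lambda>v. {i. i < d \<and> k i = v}"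
  let ?P = "Pi\<^sub>E (k ` {..<d}) (\<lambda>v. {p. p permutes ?A v})"
  define \<Phi> where "\<Phi> h = (\<lambda>v\<in>k ` {..<d}. \<lambda>i. if i \<in> ?A v then h i else i)" for h :: "nat \<Rightarrow> nat"
  have sub: "\<Phi> ` symmetries d (\<lambda>i j. k i = k j) \<subseteq> ?P"
  proof (rule image_subsetI)
    fix h assume h: "h \<in> symmetries d (\<lambda>i j. k i = k j)"
    have "(\<lambda>i. if i \<in> ?A v then h i else i) permutes ?A v" for v
    proof (rule bij_imp_permutes)
      have inj: "inj_on h (?A v)"
        using h by (auto intro: permutes_inj_on)
      have "h i \<in> ?A v" if "i \<in> ?A v" for i
        using h that permutes_in_image[of h "{..<d}" i] by auto
      then have "h ` ?A v = ?A v"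
        using inj by (intro endo_inj_surj) auto
      with inj have "bij_betw h (?A v) (?A v)"
        by (simp add: bij_betw_def)
      then show "bij_betw (\<lambda>i. if i \<in> ?A v then h i else i) (?A v) (?A v)"
        by (rule bij_betw_cong[THEN iffD1, rotated]) simp
    qed auto
    then show "\<Phi> h \<in> ?P"
      by (auto simp: \<Phi>_def)
  qed
  have inj: "inj_on \<Phi> (symmetries d (\<lambda>i j. k i = k j))"
  proof (rule inj_onI)
    fix h h' assume h: "h \<in> symmetries d (\<lambda>i j. k i = k j)" "h' \<in> symmetries d (\<lambda>i j. k i = k j)"
      and eq: "\<Phi> h = \<Phi> h'"
    show "h = h'"
    proof
      fix i
      show "h i = h' i"
      proof (cases "i < d")
        case True
        then show ?thesis
          using fun_cong[OF fun_cong[OF eq, of "k i"], of i] by (simp add: \<Phi>_def)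
      next
        case False
        then show ?thesis
          using h by (simp add: permutes_not_in[of _ "{..<d}"])
      qed
    qed
  qed
  have fin: "finite ?P"
    by (intro finite_PiE) (auto intro: finite_permutations)
  have "card (symmetries d (\<lambda>i j. k i = k j)) \<le> card ?P"
    by (rule card_inj_on_le[OF inj sub fin])
  also have "\<dots> = (\<Prod>v\<in>k ` {..<d}. fact (card (?A v)))"
    by (subst card_PiE) (auto intro!: prod.cong card_permutations)
  finally show ?thesis .
qed

text \<open>Sizes that no branch has contribute 0! = 1.\<close>

lemma Prod_any_num_branches:
  "(\<Prod>j. fact (num_branches d D j) :: real) =
     (\<Prod>v\<in>(\<lambda>i. num_leaves (branch d D i)) ` {..<d}. fact (num_branches d D v))"
proof (rule Prod_any.expand_superset)
  have "num_branches d D v = 0" if "v \<notin> (\<lambda>i. num_leaves (branch d D i)) ` {..<d}" for v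
    using that by (auto simp: num_branches_def card_eq_0_iff)
  then show "{v. fact (num_branches d D v) \<noteq> (1::real)} \<subseteq> (\<lambda>i. num_leaves (branch d D i)) ` {..<d}"
    by force
qed simp

section \<open>Densities and inducibility\<close>

text \<open>Caterpillars: each step joins the old tree and a single leaf under a new root. Thus
  \<open>Max\<close> is taken over nonempty sets.\<close>

lemma exists_dary_tree:
  assumes "2 \<le> d"
  shows "\<exists>T. dary_tree d T \<and> num_leaves T = n"
proof (cases n)
  case 0
  then show ?thesis
    by (intro exI[of _ None]) (simp add: num_leaves_None)
next
  case (Suc m)
  have "\<exists>t. dary d t \<and> num_leaves (Some t) = Suc m"
  proof (induction m)
    case 0
    show ?case
      by (intro exI[of _ "Node []"]) (simp add: num_leaves_leaf)
  next
    case (Suc m)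
    then obtain t where "dary d t" "num_leaves (Some t) = Suc m"
      by blast
    then show ?case
      using assms by (intro exI[of _ "Node [Node [], t]"]) (simp add: num_leaves_Node num_leaves_leaf)
  qed
  then show ?thesis
    using Suc by (metis option.pred_inject(2))
qed

lemma finite_densities: "finite (density D ` {T. dary_tree d T \<and> num_leaves T = n})"
proof (rule finite_subset)
  show "density D ` {T. dary_tree d T \<and> num_leaves T = n} \<subseteq>
      (\<lambda>c. real c / real (n choose num_leaves D)) ` {..n choose num_leaves D}"
    using copies_le_binomial by (auto simp: density_def)
qed simp

lemma density_nonneg: "0 \<le> density D T"
  by (simp add: density_def)

lemma density_le_1: "density D T \<le> 1"
  using copies_le_binomial[of D T] by (simp add: density_def divide_le_eq_1, linarith)

abbreviation max_density :: "nat \<Rightarrow> rtree option \<Rightarrow> nat \<Rightarrow> real" where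
  "max_density d D n \<equiv> Max (density D ` {T. dary_tree d T \<and> num_leaves T = n})"

lemma density_le_max:
  "dary_tree d T \<Longrightarrow> density D T \<le> max_density d D (num_leaves T)"
  by (intro Max_ge finite_densities) auto

lemma max_density_attained:
  assumes "2 \<le> d"
  obtains T where "dary_tree d T" "num_leaves T = n" "max_density d D n = density D T"
proof -
  have "density D ` {T. dary_tree d T \<and> num_leaves T = n} \<noteq> {}"
    using exists_dary_tree[OF assms, of n] by auto
  from Max_in[OF finite_densities this] show ?thesis
    using that by auto
qed

text \<open>All maxima lie between 0 and 1, so the upper limit is finite and
  \<open>real_of_ereal\<close> loses nothing.\<close>

lemma limsup_max_density:
  assumes "2 \<le> d"
  shows "limsup (\<lambda>n. ereal (max_density d (Some D) n)) = ereal (inducibility d (Some D))"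
    and "0 \<le> inducibility d (Some D)"
proof -
  let ?L = "limsup (\<lambda>n. ereal (max_density d (Some D) n))"
  have bounds: "0 \<le> max_density d (Some D) n" "max_density d (Some D) n \<le> 1" for n
  proof -
    obtain T where "max_density d (Some D) n = density (Some D) T"
      by (rule max_density_attained[OF assms])
    then show "0 \<le> max_density d (Some D) n" "max_density d (Some D) n \<le> 1"
      by (simp_all only: density_nonneg density_le_1)
  qed
  have "?L \<le> ereal 1"
    by (intro Limsup_bounded always_eventually allI) (simp only: ereal_less_eq bounds)
  moreover have "ereal 0 \<le> ?L"
    by (intro le_Limsup always_eventually allI trivial_limit_sequentially)
      (simp only: ereal_less_eq bounds)
  ultimately show "?L = ereal (inducibility d (Some D))" "0 \<le> inducibility d (Some D)"
    by (cases ?L; simp add: inducibility_def)+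
qed

lemma inducibility_None: "inducibility d None = 1"
  by (simp add: inducibility_def)

lemma inducibility_nonneg: "2 \<le> d \<Longrightarrow> 0 \<le> inducibility d D"
  by (cases D) (simp_all add: inducibility_None limsup_max_density)

text \<open>The upper limit controls the maximum for each number of leaves, hence \<open>N\<close>
  is uniform over all trees.\<close>

lemma eventually_density_le:
  assumes "2 \<le> d" "\<epsilon> > 0"
  obtains N where "\<And>T. dary_tree d T \<Longrightarrow> N \<le> num_leaves T \<Longrightarrow>
    density (Some D) T \<le> inducibility d (Some D) + \<epsilon>"
proof -
  have "limsup (\<lambda>n. ereal (max_density d (Some D) n)) < ereal (inducibility d (Some D) + \<epsilon>)"
    using assms by (simp add: limsup_max_density)
  from Limsup_lessD[OF this] obtain N
    where N: "\<And>n. N \<le> n \<Longrightarrow> max_density d (Some D) n < inducibility d (Some D) + \<epsilon>"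
    by (auto simp: eventually_sequentially)
  show ?thesis
  proof (rule that)
    fix T assume T: "dary_tree d T" "N \<le> num_leaves T"
    then show "density (Some D) T \<le> inducibility d (Some D) + \<epsilon>"
      using density_le_max[OF T(1), of "Some D"] N[OF T(2)] by linarith
  qed
qed

lemma inducibility_le:
  assumes "2 \<le> d" and lim: "b \<longlonglongrightarrow> \<beta>"
    and le: "\<And>T. dary_tree d T \<Longrightarrow> N \<le> num_leaves T \<Longrightarrow> density (Some D) T \<le> b (num_leaves T)"
  shows "inducibility d (Some D) \<le> \<beta>"
proof -
  have "max_density d (Some D) n \<le> b n" if "N \<le> n" for n
  proof -
    obtain T where "dary_tree d T" "num_leaves T = n" "max_density d (Some D) n = density (Some D) T"
      by (rule max_density_attained[OF assms(1)])
    then show ?thesis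
      using le[of T] that by simp
  qed
  then have "eventually (\<lambda>n. ereal (max_density d (Some D) n) \<le> ereal (b n)) sequentially"
    unfolding eventually_sequentially ereal_less_eq by blast
  then have "limsup (\<lambda>n. ereal (max_density d (Some D) n)) \<le> limsup (\<lambda>n. ereal (b n))"
    by (rule Limsup_mono)
  also have "limsup (\<lambda>n. ereal (b n)) = ereal \<beta>"
    using lim by (intro lim_imp_Limsup) auto
  finally show ?thesis
    using assms(1) by (simp add: limsup_max_density)
qed

lemma inducibility_leaf:
  assumes "2 \<le> d"
  shows "inducibility d (Some (Node [])) = 1"
proof -
  \<comment> \<open>For \<open>n = 0\<close> the density is 0/0 and so 0 by convention; the equality
    starts at 1.\<close>
  have "max_density d (Some (Node [])) n = 1" if "1 \<le> n" for n
  proof -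
    obtain T where T: "num_leaves T = n" "max_density d (Some (Node [])) n = density (Some (Node [])) T"
      by (rule max_density_attained[OF assms])
    then show ?thesis
      using that by (simp add: density_def copies_leaf num_leaves_leaf)
  qed
  then have "eventually (\<lambda>n. ereal (max_density d (Some (Node [])) n) = ereal 1) sequentially"
    unfolding eventually_sequentially by metis
  then have "(\<lambda>n. ereal (max_density d (Some (Node [])) n)) \<longlonglongrightarrow> ereal 1"
    by (rule tendsto_eventually)
  then have "limsup (\<lambda>n. ereal (max_density d (Some (Node [])) n)) = ereal 1"
    by (intro lim_imp_Limsup) auto
  then show ?thesis
    using limsup_max_density(1)[OF assms, of "Node []"] by simp
qed

lemma dary_one_leaf:
  assumes "dary d t" "num_leaves (Some t) \<le> 1"
  shows "t = Node []"
proof (cases t)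
  case (Node ts)
  have False if "ts \<noteq> []"
  proof -
    have len: "2 \<le> length ts"
      using assms(1) Node that by auto
    have "(\<Sum>i<length ts. 1) \<le> (\<Sum>i<length ts. num_leaves (Some (ts ! i)))"
      using num_leaves_pos by (intro sum_mono) (simp add: Suc_le_eq)
    then show False
      using assms(2) Node that len by (simp add: num_leaves_Node)
  qed
  then show ?thesis
    using Node by blast
qed

text \<open>For trees with at most one leaf no additive constant is allowed: this is what makes the
  error in the recursion of order \<open>n ^ (k - 2)\<close> at each of the fewer than \<open>n\<close> internal vertices.\<close>

lemma copies_le_inducibility:
  assumes "2 \<le> d" "dary_tree d D" "\<epsilon> > 0"
  obtains B where "B \<ge> 0" "\<And>T. dary_tree d T \<Longrightarrow> real (copies D T) \<le>
    (inducibility d D + \<epsilon>) * real (num_leaves T choose num_leaves D) +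
    (if num_leaves D \<le> 1 then 0 else B)"
proof (cases "num_leaves D \<le> 1")
  case True
  have "inducibility d D = 1"
  proof (cases D)
    case (Some t)
    then show ?thesis
      using dary_one_leaf[of d t] True assms inducibility_leaf by simp
  qed (simp add: inducibility_None)
  moreover have "1 * real (num_leaves T choose num_leaves D) \<le> (1 + \<epsilon>) * real (num_leaves T choose num_leaves D)" for T
    using assms(3) by (intro mult_right_mono) auto
  moreover have "real (copies D T) \<le> real (num_leaves T choose num_leaves D)" for T
    using copies_le_binomial by simp
  ultimately show ?thesis
    using that[of 0] True by (simp, meson order_trans)
next
  case False
  then obtain t where t: "D = Some t"
    by (cases D) (auto simp: num_leaves_None)
  obtain N where N: "\<And>T. dary_tree d T \<Longrightarrow> N \<le> num_leaves T \<Longrightarrow>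
      density D T \<le> inducibility d D + \<epsilon>"
    using eventually_density_le[OF assms(1,3)] t by metis
  show ?thesis
  \<comment> \<open>Trees with fewer than \<open>N\<close> leaves escape the density bound, but have
    at most \<open>2 ^ N\<close> sets of leaves.\<close>
  proof (rule that[of "2 ^ N"])
    fix T assume T: "dary_tree d T"
    let ?b = "num_leaves T choose num_leaves D"
    have pos: "0 \<le> inducibility d D + \<epsilon>"
      using inducibility_nonneg[OF assms(1), of D] assms(3) by simp
    have "real (copies D T) \<le> (inducibility d D + \<epsilon>) * real ?b + 2 ^ N"
    proof (cases "N \<le> num_leaves T")
      case True
      have "real (copies D T) \<le> (inducibility d D + \<epsilon>) * real ?b"
      \<comment> \<open>Division by 0 makes the density uninformative here, but then there are no
        copies at all.\<close>
      proof (cases "?b = 0")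
        case True
        then have "copies D T = 0"
          using copies_le_binomial[of D T] unfolding True by simp
        then show ?thesis
          unfolding True by simp
      next
        case False
        then show ?thesis
          using N[OF T True] by (simp add: density_def pos_divide_le_eq)
      qed
      then show ?thesis
        by (simp add: add_increasing2)
    next
      case False
      have "copies D T \<le> 2 ^ num_leaves T"
        using copies_le_binomial binomial_le_pow2 order_trans by blast
      also have "\<dots> \<le> 2 ^ N"
        using False by (intro power_increasing) auto
      finally have "real (copies D T) \<le> 2 ^ N"
        by (metis of_nat_le_iff of_nat_numeral of_nat_power)
      then show ?thesis
        using pos by (simp add: add_increasing)
    qed
    then show "real (copies D T) \<le> (inducibility d D + \<epsilon>) * real ?b + (if num_leaves D \<le> 1 then 0 else 2 ^ N)"
      using False by simp
  qed simp
qed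

text \<open>In the expanded product, every term except the product of the \<open>x j\<close>
  contains some \<open>y j\<close> and hence a factor \<delta>; further such factors are at most 1.
  The 2 in each factor pays for the number of terms.\<close>

lemma prod_add_le:
  fixes x y w :: "'a \<Rightarrow> real"
  assumes "finite J" "0 \<le> c" "0 \<le> \<delta>" "\<delta> \<le> 1"
    and "\<And>j. j \<in> J \<Longrightarrow> 0 \<le> x j \<and> x j \<le> c * w j"
    and "\<And>j. j \<in> J \<Longrightarrow> 0 \<le> y j \<and> y j \<le> c * w j * \<delta>"
    and "\<And>j. j \<in> J \<Longrightarrow> 0 \<le> w j"
  shows "(\<Prod>j\<in>J. x j + y j) \<le> (\<Prod>j\<in>J. x j) + \<delta> * (\<Prod>j\<in>J. 2 * c * w j)"
  using assms
proof (induction J rule: finite_induct)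
  case (insert i J)
  let ?P = "\<Prod>j\<in>J. x j + y j" and ?X = "\<Prod>j\<in>J. x j" and ?W = "\<Prod>j\<in>J. 2 * c * w j"
  have i: "0 \<le> x i" "x i \<le> c * w i" "0 \<le> y i" "y i \<le> c * w i * \<delta>" "0 \<le> w i"
    using insert.prems by auto
  have cw: "0 \<le> c * w j" "c * w j * \<delta> \<le> c * w j" if "j \<in> insert i J" for j
    using insert.prems that by (auto intro!: mult_left_le)
  have IH: "?P \<le> ?X + \<delta> * ?W"
    using insert.prems by (intro insert.IH) auto
  have PW: "?P \<le> ?W"
  proof (rule prod_mono)
    fix j assume "j \<in> J"
    then show "0 \<le> x j + y j \<and> x j + y j \<le> 2 * c * w j"
      using insert.prems(4,5)[of j] cw[of j] by auto
  qed
  have W: "0 \<le> ?W"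
    using insert.prems by (intro prod_nonneg) auto
  have "(x i + y i) * ?P = x i * ?P + y i * ?P"
    by (simp add: distrib_right)
  also have "\<dots> \<le> x i * (?X + \<delta> * ?W) + y i * ?W"
    using i IH PW by (intro add_mono mult_left_mono) auto
  also have "\<dots> = x i * ?X + x i * (\<delta> * ?W) + y i * ?W"
    by (simp add: distrib_left)
  also have "\<dots> \<le> x i * ?X + c * w i * (\<delta> * ?W) + c * w i * \<delta> * ?W"
    using i W insert.prems(2) by (intro add_mono mult_right_mono order_refl) auto
  also have "\<dots> = x i * ?X + \<delta> * (2 * c * w i * ?W)"
    by (simp add: algebra_simps)
  finally show ?case
    using insert.hyps by simp
qed simp

section \<open>The upper bound\<close>

abbreviation (input) branch_symmetries :: "nat \<Rightarrow> rtree \<Rightarrow> (nat \<Rightarrow> nat) set" where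
  "branch_symmetries d D \<equiv> symmetries d (\<lambda>i j. isomorphic (branch d D i) (branch d D j))"

abbreviation (input) size_symmetries :: "nat \<Rightarrow> rtree \<Rightarrow> (nat \<Rightarrow> nat) set" where
  "size_symmetries d D \<equiv> symmetries d (\<lambda>i j. num_leaves (branch d D i) = num_leaves (branch d D j))"

section \<open>Sums over the representatives\<close>

lemma representatives_permutes: "representatives d D M \<Longrightarrow> \<rho> \<in> M \<Longrightarrow> \<rho> permutes {..<d}"
  by (auto simp: representatives_def)

lemma sum_permutations_representatives:
  fixes F :: "(nat \<Rightarrow> nat) \<Rightarrow> real"
  assumes M: "representatives d D M"
    and F: "\<And>\<pi> \<rho>. perm_equiv d D \<pi> \<rho> \<Longrightarrow> F \<pi> = F \<rho>"
  shows "(\<Sum>\<pi> | \<pi> permutes {..<d}. F \<pi>) = real (card (branch_symmetries d D)) * sum F M"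
proof (rule sum_over_representatives[where E = "perm_equiv d D"])
  show "\<exists>!\<rho>. \<rho> \<in> M \<and> perm_equiv d D \<pi> \<rho>" if "\<pi> \<in> {\<pi>. \<pi> permutes {..<d}}" for \<pi>
    using M that unfolding representatives_def by blast
  show "card {\<pi> \<in> {\<pi>. \<pi> permutes {..<d}}. perm_equiv d D \<pi> \<rho>} = card (branch_symmetries d D)"
    if "\<rho> \<in> M" for \<rho>
    using card_permutation_class[OF representatives_permutes[OF M that],
        of "\<lambda>i j. isomorphic (branch d D i) (branch d D j)"]
    by (simp add: perm_equiv_def)
qed (use M F in \<open>auto simp: finite_permutations representatives_def\<close>)

lemma card_representatives:
  assumes "representatives d D M"
  shows "real (card (branch_symmetries d D)) * real (card M) = fact d"
  using sum_permutations_representatives[OF assms, of "\<lambda>_. 1"] card_permutations[of "{..<d}" d]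
  by simp

text \<open>The sum over all permutations is grouped in two ways: by the isomorphism types of the
  branches, which gives \<open>M\<close>, and by their leaf counts, which gives the arrangements.
  The quotient of the class sizes is rewritten with \<open>card_representatives\<close>.\<close>

lemma sum_representatives_arrangements:
  fixes n :: "nat \<Rightarrow> nat"
  assumes M: "representatives d D M"
  shows "(\<Sum>\<rho>\<in>M. \<Prod>j<d. real (n j choose num_leaves (branch d D (\<rho> j)))) =
    real (card M) * real (card (size_symmetries d D)) / fact d *
    (\<Sum>a\<in>arrangements d (\<lambda>i. num_leaves (branch d D i)). \<Prod>j<d. real (n j choose a j))"
proof -
  let ?k = "\<lambda>i. num_leaves (branch d D i)"
  let ?F = "\<lambda>\<pi>. \<Prod>j<d. real (n j choose ?k (\<pi> j))"
  let ?A = "\<Sum>a\<in>arrangements d ?k. \<Prod>j<d. real (n j choose a j)"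
  have H: "real (card (branch_symmetries d D)) * real (card M) = fact d"
    by (rule card_representatives[OF M])
  then have nz: "real (card (branch_symmetries d D)) \<noteq> 0"
    by (metis fact_nonzero mult_zero_left)
  have "real (card (branch_symmetries d D)) * sum ?F M = (\<Sum>\<pi> | \<pi> permutes {..<d}. ?F \<pi>)"
    by (rule sum_permutations_representatives[OF M, symmetric])
      (auto simp: perm_equiv_def isomorphic_num_leaves intro!: prod.cong)
  also have "\<dots> = real (card (size_symmetries d D)) * ?A"
    using sum_permutations_arrangements[of "\<lambda>a. \<Prod>j<d. real (n j choose a j)" ?k d] by simp
  finally have "real (card (branch_symmetries d D)) * real (card M) * sum ?F M =
      real (card M) * (real (card (size_symmetries d D)) * ?A)"
    by simp
  then show ?thesis
    unfolding H by (simp add: field_simps)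
qed

section \<open>Error terms of the recursion\<close>

lemma num_leaves_branch_le:
  assumes "dary d (Node ts)" "ts \<noteq> []" "j < d"
  shows "num_leaves (branch d (Node ts) j) \<le> num_leaves (Some (Node ts))"
  unfolding num_leaves_branches[OF assms(1,2)] using assms(3) by (intro member_le_sum) auto

text \<open>There are at least two nonempty branches.\<close>

lemma sum_pred_num_leaves_branches:
  assumes "dary d (Node ts)" "ts \<noteq> []"
  shows "(\<Sum>j<d. num_leaves (branch d (Node ts) j) - 1) + 2 \<le> num_leaves (Some (Node ts))"
proof -
  let ?n = "\<lambda>j. num_leaves (branch d (Node ts) j)"
  have len: "2 \<le> length ts" "length ts \<le> d"
    using assms by auto
  then have pos: "?n 0 > 0" "?n 1 > 0"
    by (auto simp: branch_Node num_leaves_pos)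
  \<comment> \<open>\<open>min 1 (?n j)\<close> indicates a nonempty branch; adding it to the
    truncated difference \<open>?n j - 1\<close> gives \<open>?n j\<close> for empty branches
    too.\<close>
  have "2 = (\<Sum>j\<in>{0,1}. min 1 (?n j))"
    using pos by simp
  also have "\<dots> \<le> (\<Sum>j<d. min 1 (?n j))"
    using len by (intro sum_mono2) auto
  finally have "(\<Sum>j<d. ?n j - 1) + 2 \<le> (\<Sum>j<d. (?n j - 1) + min 1 (?n j))"
    by (simp add: sum.distrib)
  also have "\<dots> = (\<Sum>j<d. ?n j)"
    by (intro sum.cong) auto
  finally show ?thesis
    using num_leaves_branches[OF assms] by simp
qed

text \<open>A tree with n leaves has at most n - 1 internal vertices, and each is charged
  \<open>n ^ q\<close>. The branches together use at most n - 2 of these shares, which leaves one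
  for the root.\<close>

lemma error_recursion:
  assumes "dary d (Node ts)" "ts \<noteq> []"
  defines "n \<equiv> num_leaves (Some (Node ts))" and "m \<equiv> \<lambda>j. num_leaves (branch d (Node ts) j)"
  shows "(\<Sum>j<d. (m j - 1) * m j ^ q) + n ^ q \<le> (n - 1) * n ^ q"
proof -
  have "(\<Sum>j<d. (m j - 1) * m j ^ q) \<le> (\<Sum>j<d. (m j - 1) * n ^ q)"
    unfolding n_def m_def using num_leaves_branch_le[OF assms(1,2)]
    by (intro sum_mono mult_left_mono power_mono) auto
  also have "\<dots> = (\<Sum>j<d. m j - 1) * n ^ q"
    by (simp add: sum_distrib_right)
  finally have "(\<Sum>j<d. (m j - 1) * m j ^ q) + n ^ q \<le> ((\<Sum>j<d. m j - 1) + 1) * n ^ q"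
    by simp
  also have "\<dots> \<le> (n - 1) * n ^ q"
    using sum_pred_num_leaves_branches[OF assms(1,2)] unfolding n_def m_def
    by (intro mult_right_mono) auto
  finally show ?thesis .
qed

lemma binomial_le_power: "n choose k \<le> n ^ k"
  by (cases "k \<le> n") (simp_all add: binomial_le_pow binomial_eq_0)

lemma prod_copies_le:
  fixes \<alpha> B :: "nat \<Rightarrow> real" and n :: nat
  assumes \<rho>: "\<rho> permutes {..<d}" and n: "1 \<le> n"
    and le: "\<And>j. j < d \<Longrightarrow> real (c j) \<le>
      \<alpha> (\<rho> j) * real (m j choose k (\<rho> j)) + (if k (\<rho> j) \<le> 1 then 0 else B (\<rho> j))"
    and m: "\<And>j. j < d \<Longrightarrow> m j \<le> n"
    and \<alpha>: "\<And>i. i < d \<Longrightarrow> 0 \<le> \<alpha> i \<and> \<alpha> i \<le> b"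
    and B: "\<And>i. i < d \<Longrightarrow> 0 \<le> B i \<and> B i \<le> b"
    and b: "0 \<le> b" and k: "2 \<le> sum k {..<d}"
  shows "(\<Prod>j<d. real (c j)) \<le>
    prod \<alpha> {..<d} * (\<Prod>j<d. real (m j choose k (\<rho> j))) + (2 * b) ^ d * real n ^ (sum k {..<d} - 2)"
proof -
  define x where "x j = \<alpha> (\<rho> j) * real (m j choose k (\<rho> j))" for j
  define y where "y j = (if k (\<rho> j) \<le> 1 then 0 else B (\<rho> j))" for j
  \<comment> \<open>The scale uses the size \<open>n\<close> of the whole tree instead of
    \<open>m j\<close>: the constant \<open>B (\<rho> j)\<close> is present even if
    \<open>m j = 0\<close>, and the powers of \<open>n\<close> multiply to an expression independent
    of \<open>\<rho>\<close>.\<close>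
  define w where "w j = real n ^ k (\<rho> j)" for j
  \<comment> \<open>The relative error of one factor: a constant occurs only for exponents q \<ge>
    2, where 1 is at most \<open>n ^ q\<close> divided by \<open>n ^ 2\<close>.\<close>
  define \<delta> where "\<delta> = 1 / real n ^ 2"
  have \<rho>d: "\<rho> j < d" if "j < d" for j
    using permutes_in_image[OF \<rho>, of j] that by simp
  have square: "real n ^ q * \<delta> = real n ^ (q - 2)" if "2 \<le> q" for q
  proof -
    have "real n ^ q = real n ^ (q - 2) * real n ^ 2"
      using that by (metis le_add_diff_inverse2 power_add)
    then show ?thesis
      using n by (simp add: \<delta>_def)
  qed
  have "(\<Prod>j<d. real (c j)) \<le> (\<Prod>j<d. x j + y j)"
    using le by (intro prod_mono) (auto simp: x_def y_def)
  also have "\<dots> \<le> prod x {..<d} + \<delta> * (\<Prod>j<d. 2 * b * w j)"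
  proof (rule prod_add_le)
    show "\<delta> \<le> 1"
      using n by (simp add: \<delta>_def divide_le_eq_1)
    show "0 \<le> x j \<and> x j \<le> b * w j" if "j \<in> {..<d}" for j
    proof -
      have j: "j < d"
        using that by simp
      have "real (m j choose k (\<rho> j)) \<le> real (m j ^ k (\<rho> j))"
        using binomial_le_power by simp
      also have "\<dots> \<le> w j"
        unfolding w_def using m[OF j] by (simp add: power_mono)
      finally show ?thesis
        unfolding x_def using \<alpha>[OF \<rho>d[OF j]] b by (auto intro!: mult_mono)
    qed
    show "0 \<le> y j \<and> y j \<le> b * w j * \<delta>" if "j \<in> {..<d}" for j
    proof (cases "k (\<rho> j) \<le> 1")
      case True
      then show ?thesis
        using b by (simp add: y_def w_def \<delta>_def)
    next
      case False
      have j: "j < d"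
        using that by simp
      have "w j * \<delta> = real n ^ (k (\<rho> j) - 2)"
        using False square by (simp add: w_def)
      moreover have "1 \<le> real n ^ (k (\<rho> j) - 2)"
        using n by (intro one_le_power) simp
      ultimately have "b * 1 \<le> b * (w j * \<delta>)"
        using b by (intro mult_left_mono) auto
      then show ?thesis
        using B[OF \<rho>d[OF j]] False by (simp add: y_def mult.assoc)
    qed
  qed (use b in \<open>auto simp: \<delta>_def w_def\<close>)
  also have "prod x {..<d} = prod \<alpha> {..<d} * (\<Prod>j<d. real (m j choose k (\<rho> j)))"
    unfolding x_def prod.distrib using prod.permute[OF \<rho>, of \<alpha>] by (simp add: comp_def)
  also have "\<delta> * (\<Prod>j<d. 2 * b * w j) = (2 * b) ^ d * (real n ^ sum k {..<d} * \<delta>)"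
  proof -
    have "prod w {..<d} = real n ^ sum k {..<d}"
      unfolding w_def using sum.permute[OF \<rho>, of k] by (simp add: power_sum[symmetric] comp_def)
    then show ?thesis
      unfolding prod.distrib by simp
  qed
  finally show ?thesis
    unfolding square[OF k] .
qed

text \<open>For representatives \<open>M\<close> this is the index of the branch symmetries in the
  size symmetries. Keeping the group order instead of the product of factorials lets the second
  claim follow from equality of the two groups.\<close>

abbreviation (input) weight :: "nat \<Rightarrow> rtree \<Rightarrow> (nat \<Rightarrow> nat) set \<Rightarrow> real" where
  "weight d D M \<equiv> real (card M) * real (card (size_symmetries d D)) / fact d"

text \<open>Structural induction with \<open>K\<close> fixed beforehand. Both summands reproduce
  themselves: \<open>arrangements_binomial_le\<close> closes the main term and
  \<open>error_recursion\<close> the error.\<close>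

lemma copies_upper_bound:
  assumes d: "2 \<le> d" and D: "dary d (Node ds)" "ds \<noteq> []"
    and M: "representatives d (Node ds) M" and \<epsilon>: "\<epsilon> > 0"
  defines "D \<equiv> Node ds"
  defines "Q \<equiv> weight d D M * (\<Prod>i<d. inducibility d (branch d D i) + \<epsilon>)"
  obtains K where "\<And>t. dary d t \<Longrightarrow> real (copies (Some D) (Some t)) \<le>
    Q * real (num_leaves (Some t) choose num_leaves (Some D)) +
    K * real ((num_leaves (Some t) - 1) * num_leaves (Some t) ^ (num_leaves (Some D) - 2))"
proof -
  define k where "k i = num_leaves (branch d D i)" for i
  define s where "s = num_leaves (Some D)"
  define \<alpha> where "\<alpha> i = inducibility d (branch d D i) + \<epsilon>" for i
  have s_sum: "s = sum k {..<d}"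
    unfolding s_def k_def D_def by (rule num_leaves_branches[OF D])
  have len: "2 \<le> length ds" "length ds \<le> d"
    using D by auto
  then have k01: "k 0 > 0" "k 1 > 0"
    by (auto simp: k_def D_def branch_Node num_leaves_pos)
  have s2: "2 \<le> s"
    using sum_pred_num_leaves_branches[OF D] by (simp add: s_def D_def)
  have \<alpha>0: "0 \<le> \<alpha> i" for i
    using inducibility_nonneg[OF d] \<epsilon> by (simp add: \<alpha>_def add_nonneg_nonneg)
  have "\<exists>b\<ge>0. \<forall>T. dary_tree d T \<longrightarrow> real (copies (branch d D i) T) \<le>
      \<alpha> i * real (num_leaves T choose k i) + (if k i \<le> 1 then 0 else b)" if "i < d" for i
    using copies_le_inducibility[OF d _ \<epsilon>, of "branch d D i"] dary_branch[OF D(1) that]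
    unfolding \<alpha>_def k_def D_def by metis
  then have "\<forall>i\<in>{..<d}. \<exists>b. 0 \<le> b \<and> (\<forall>T. dary_tree d T \<longrightarrow> real (copies (branch d D i) T) \<le>
      \<alpha> i * real (num_leaves T choose k i) + (if k i \<le> 1 then 0 else b))"
    by auto
  from bchoice[OF this] obtain B where B0: "\<And>i. i < d \<Longrightarrow> 0 \<le> B i"
    and B: "\<And>i T. i < d \<Longrightarrow> dary_tree d T \<Longrightarrow> real (copies (branch d D i) T) \<le>
      \<alpha> i * real (num_leaves T choose k i) + (if k i \<le> 1 then 0 else B i)"
    by auto
  define b where "b = sum \<alpha> {..<d} + sum B {..<d}"
  have \<alpha>B: "\<alpha> i \<le> b" "B i \<le> b" if "i < d" for i
  proof -
    have "\<alpha> i \<le> sum \<alpha> {..<d}" "B i \<le> sum B {..<d}"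
      using that \<alpha>0 B0 by (auto intro!: member_le_sum)
    moreover have "0 \<le> sum \<alpha> {..<d}" "0 \<le> sum B {..<d}"
      using \<alpha>0 B0 by (auto intro!: sum_nonneg)
    ultimately show "\<alpha> i \<le> b" "B i \<le> b"
      by (auto simp: b_def)
  qed
  have b0: "0 \<le> b"
    using \<alpha>0 B0 by (auto simp: b_def intro!: add_nonneg_nonneg sum_nonneg)
  \<comment> \<open>Each of the \<open>card M\<close> products in the recursion has an error of at
    most \<open>(2 * b) ^ d * n ^ (s - 2)\<close>.\<close>
  define K where "K = real (card M) * (2 * b) ^ d"
  have K0: "0 \<le> K"
    using b0 by (simp add: K_def)
  have P0: "0 \<le> prod \<alpha> {..<d}"
    using \<alpha>0 by (intro prod_nonneg) auto
  have Q_eq: "Q = weight d D M * prod \<alpha> {..<d}"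
    by (simp add: Q_def \<alpha>_def)
  have Q0: "0 \<le> Q"
    unfolding Q_eq using P0 by simp
  have "real (copies (Some D) (Some t)) \<le> Q * real (num_leaves (Some t) choose s) +
      K * real ((num_leaves (Some t) - 1) * num_leaves (Some t) ^ (s - 2))" if "dary d t" for t
    using that
  proof (induction t)
    case (Node ts)
    show ?case
    proof (cases "ts = []")
      case True
      have "copies (Some D) (Some (Node ts)) = 0"
        using copies_le_binomial[of "Some D" "Some (Node ts)"] s2 True
        by (simp add: num_leaves_leaf binomial_eq_0 s_def)
      then show ?thesis
        using Q0 K0 by simp
    next
      case False
      define T where "T j = branch d (Node ts) j" for j
      define n where "n = num_leaves (Some (Node ts))"
      define m where "m j = num_leaves (T j)" for j
      have lts: "2 \<le> length ts" "length ts \<le> d"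
        using Node.prems False by auto
      have n_sum: "n = sum m {..<d}"
        unfolding n_def m_def T_def by (rule num_leaves_branches[OF Node.prems False])
      have n1: "1 \<le> n"
        using num_leaves_pos[of "Node ts"] by (simp add: n_def)
      have mn: "m j \<le> n" if "j < d" for j
        unfolding m_def n_def T_def by (rule num_leaves_branch_le[OF Node.prems False that])
      have IH: "real (copies (Some D) (T j)) \<le>
          Q * real (m j choose s) + K * real ((m j - 1) * m j ^ (s - 2))" if "j < d" for j
      proof (cases "j < length ts")
        case True
        then have "T j = Some (ts ! j)" "dary d (ts ! j)"
          using that lts Node.prems by (auto simp: T_def branch_Node)
        then show ?thesis
          using Node.IH[of "ts ! j"] True by (simp add: m_def)
      next
        case False
        then have "T j = None"
          using that lts by (simp add: T_def branch_Node)
        moreover have "copies (Some D) None = 0"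
          using copies_le_binomial[of "Some D" None] s2
          by (simp add: num_leaves_None binomial_eq_0 s_def)
        ultimately show ?thesis
          using Q0 K0 by simp
      qed
      have prod_le: "(\<Prod>j<d. real (copies (branch d D (\<rho> j)) (T j))) \<le>
          prod \<alpha> {..<d} * (\<Prod>j<d. real (m j choose k (\<rho> j))) + (2 * b) ^ d * real n ^ (s - 2)"
        if "\<rho> \<in> M" for \<rho>
        unfolding s_sum
      proof (rule prod_copies_le)
        show \<rho>: "\<rho> permutes {..<d}"
          by (rule representatives_permutes[OF M that])
        show "real (copies (branch d D (\<rho> j)) (T j)) \<le>
            \<alpha> (\<rho> j) * real (m j choose k (\<rho> j)) + (if k (\<rho> j) \<le> 1 then 0 else B (\<rho> j))"
          if "j < d" for j
          unfolding m_def T_def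
        proof (rule B)
          show "\<rho> j < d"
            using permutes_in_image[OF \<rho>, of j] that by simp
        qed (rule dary_branch[OF Node.prems that])
      qed (use n1 mn \<alpha>0 \<alpha>B B0 b0 s2 in \<open>simp_all add: s_sum\<close>)
      have "real (copies (Some D) (Some (Node ts))) \<le>
          real ((\<Sum>j<d. copies (Some D) (T j)) + (\<Sum>\<rho>\<in>M. \<Prod>j<d. copies (branch d D (\<rho> j)) (T j)))"
        unfolding T_def D_def of_nat_le_iff
        by (rule copies_recursion[OF len(2) D(2) lts(2) False M])
      also have "\<dots> = (\<Sum>j<d. real (copies (Some D) (T j))) +
          (\<Sum>\<rho>\<in>M. \<Prod>j<d. real (copies (branch d D (\<rho> j)) (T j)))"
        by simp
      also have "\<dots> \<le> (\<Sum>j<d. Q * real (m j choose s) + K * real ((m j - 1) * m j ^ (s - 2))) +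
          (\<Sum>\<rho>\<in>M. prod \<alpha> {..<d} * (\<Prod>j<d. real (m j choose k (\<rho> j))) + (2 * b) ^ d * real n ^ (s - 2))"
        using IH prod_le by (intro add_mono sum_mono) auto
      also have "\<dots> = (\<Sum>j<d. Q * real (m j choose s)) + K * real (\<Sum>j<d. (m j - 1) * m j ^ (s - 2)) +
          (prod \<alpha> {..<d} * (\<Sum>\<rho>\<in>M. \<Prod>j<d. real (m j choose k (\<rho> j))) + K * real (n ^ (s - 2)))"
        by (simp add: sum.distrib sum_distrib_left K_def)
      also have "\<dots> = Q * real (\<Sum>j<d. m j choose s) +
          prod \<alpha> {..<d} * (\<Sum>\<rho>\<in>M. \<Prod>j<d. real (m j choose k (\<rho> j))) +
          K * real ((\<Sum>j<d. (m j - 1) * m j ^ (s - 2)) + n ^ (s - 2))"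
        by (simp add: sum_distrib_left distrib_left)
      \<comment> \<open>Regrouping by size vectors produces the same coefficient \<open>Q\<close>
        that the copies inside branches carry, so both can be bounded by one binomial
        coefficient.\<close>
      also have "prod \<alpha> {..<d} * (\<Sum>\<rho>\<in>M. \<Prod>j<d. real (m j choose k (\<rho> j))) =
          Q * real (\<Sum>a\<in>arrangements d k. \<Prod>j<d. m j choose a j)"
        using sum_representatives_arrangements[OF M, of m]
        by (simp add: Q_eq k_def[abs_def] D_def)
      also have "Q * real (\<Sum>j<d. m j choose s) + Q * real (\<Sum>a\<in>arrangements d k. \<Prod>j<d. m j choose a j) =
          Q * real ((\<Sum>a\<in>arrangements d k. \<Prod>j<d. m j choose a j) + (\<Sum>j<d. m j choose s))"
        by (simp add: distrib_left)
      also have "\<dots> + K * real ((\<Sum>j<d. (m j - 1) * m j ^ (s - 2)) + n ^ (s - 2)) \<le>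
          Q * real (n choose s) + K * real ((n - 1) * n ^ (s - 2))"
      proof (intro add_mono mult_left_mono Q0 K0)
        show "real ((\<Sum>a\<in>arrangements d k. \<Prod>j<d. m j choose a j) + (\<Sum>j<d. m j choose s)) \<le> real (n choose s)"
          unfolding s_sum n_sum of_nat_le_iff by (rule arrangements_binomial_le[where n = m, OF d k01])
        show "real ((\<Sum>j<d. (m j - 1) * m j ^ (s - 2)) + n ^ (s - 2)) \<le> real ((n - 1) * n ^ (s - 2))"
          unfolding m_def n_def T_def of_nat_le_iff by (rule error_recursion[OF Node.prems False])
      qed
      finally show ?thesis
        by (simp only: n_def)
    qed
  qed
  then show ?thesis
    using that unfolding s_def by blast
qed

section \<open>Passage to the limit\<close>

lemma error_over_binomial_tendsto_0:
  assumes "2 \<le> s"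
  shows "(\<lambda>n. real ((n - 1) * n ^ (s - 2)) / real (n choose s)) \<longlonglongrightarrow> 0"
proof (rule tendsto_sandwich[where f = "\<lambda>_. 0"])
  \<comment> \<open>The numerator is at most \<open>n ^ (s - 1)\<close>, while
    \<open>n choose s\<close> is at least \<open>(n / s) ^ s\<close>.\<close>
  show "eventually (\<lambda>n. real ((n - 1) * n ^ (s - 2)) / real (n choose s) \<le> real s ^ s * (1 / real n)) sequentially"
  proof (rule eventually_sequentiallyI)
    fix n assume n: "s \<le> n"
    have pos: "0 < real n" "0 < real s"
      using n assms by auto
    have "real n * real ((n - 1) * n ^ (s - 2)) \<le> real n * real (n * n ^ (s - 2))"
      by (intro mult_left_mono of_nat_mono mult_right_mono) auto
    also have "\<dots> = real n ^ s"
    proof -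
      have "real n ^ s = real n ^ 2 * real n ^ (s - 2)"
        using assms by (metis le_add_diff_inverse power_add)
      then show ?thesis
        by (simp add: power2_eq_square)
    qed
    also have "\<dots> = real s ^ s * (real n / real s) ^ s"
      using pos by (simp add: power_divide)
    also have "\<dots> \<le> real s ^ s * real (n choose s)"
      using binomial_ge_n_over_k_pow_k[OF n, where 'a = real] by (intro mult_left_mono) auto
    finally show "real ((n - 1) * n ^ (s - 2)) / real (n choose s) \<le> real s ^ s * (1 / real n)"
      using n pos by (simp add: field_simps)
  qed
  show "(\<lambda>n. real s ^ s * (1 / real n)) \<longlonglongrightarrow> 0"
    by (rule tendsto_mult_right_zero[OF lim_1_over_n])
qed auto

text \<open>The order of the limits matters: \<open>K\<close> depends on \<epsilon>, but its term
  vanishes as n grows for each fixed \<epsilon>. Then \<epsilon> tends to 0 from the right, and the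
  product is continuous in \<epsilon>.\<close>

lemma inducibility_le_weight:
  assumes d: "2 \<le> d" and D: "dary d (Node ds)" "ds \<noteq> []"
    and M: "representatives d (Node ds) M"
  defines "D \<equiv> Node ds"
  shows "inducibility d (Some D) \<le> weight d D M * (\<Prod>i<d. inducibility d (branch d D i))"
proof (rule tendsto_lowerbound)
  let ?Q = "\<lambda>\<epsilon>. weight d D M * (\<Prod>i<d. inducibility d (branch d D i) + \<epsilon>)"
  have "((\<lambda>\<epsilon>. ?Q \<epsilon>) \<longlongrightarrow> weight d D M * (\<Prod>i<d. inducibility d (branch d D i) + 0)) (at_right 0)"
    by (intro tendsto_intros)
  then show "((\<lambda>\<epsilon>. ?Q \<epsilon>) \<longlongrightarrow> weight d D M * (\<Prod>i<d. inducibility d (branch d D i))) (at_right 0)"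
    by simp
  have "inducibility d (Some D) \<le> ?Q \<epsilon>" if \<epsilon>: "\<epsilon> > 0" for \<epsilon>
  proof -
    define s where "s = num_leaves (Some D)"
    define e where "e n = real ((n - 1) * n ^ (s - 2))" for n
    have s2: "2 \<le> s"
      using sum_pred_num_leaves_branches[OF D] by (simp add: s_def D_def)
    obtain K where K: "\<And>t. dary d t \<Longrightarrow> real (copies (Some D) (Some t)) \<le>
        ?Q \<epsilon> * real (num_leaves (Some t) choose s) + K * e (num_leaves (Some t))"
      using copies_upper_bound[OF d D M \<epsilon>] unfolding s_def e_def D_def by blast
    show ?thesis
    proof (rule inducibility_le[OF d, where b = "\<lambda>n. ?Q \<epsilon> + K * (e n / real (n choose s))" and N = s])
      have "(\<lambda>n. ?Q \<epsilon> + K * (e n / real (n choose s))) \<longlonglongrightarrow> ?Q \<epsilon> + K * 0"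
        unfolding e_def by (intro tendsto_intros error_over_binomial_tendsto_0[OF s2])
      then show "(\<lambda>n. ?Q \<epsilon> + K * (e n / real (n choose s))) \<longlonglongrightarrow> ?Q \<epsilon>"
        by simp
      fix T assume T: "dary_tree d T" "s \<le> num_leaves T"
      then obtain t where t: "T = Some t" "dary d t"
        using s2 by (cases T) (auto simp: num_leaves_None)
      have pos: "real (num_leaves T choose s) > 0"
        using T(2) by simp
      have "density (Some D) T \<le> (?Q \<epsilon> * real (num_leaves T choose s) + K * e (num_leaves T)) / real (num_leaves T choose s)"
        unfolding density_def s_def[symmetric] using K[OF t(2)] t(1) by (intro divide_right_mono) auto
      also have "\<dots> = ?Q \<epsilon> + K * (e (num_leaves T) / real (num_leaves T choose s))"
        using pos by (simp only: add_divide_distrib) simp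
      finally show "density (Some D) T \<le> ?Q \<epsilon> + K * (e (num_leaves T) / real (num_leaves T choose s))" .
    qed
  qed
  then show "eventually (\<lambda>\<epsilon>. inducibility d (Some D) \<le> ?Q \<epsilon>) (at_right 0)"
    using eventually_at_right_less[of "0 :: real"] by (auto elim: eventually_mono)
qed simp

theorem corollary5:
  fixes d :: nat and D :: rtree and M :: "(nat \<Rightarrow> nat) set"
  assumes "2 \<le> d"
    and "dary d D"
    and "2 \<le> num_leaves (Some D)"
    and "representatives d D M"
  shows "inducibility d (Some D)
           \<le> real (card M) * (\<Prod>j. fact (num_branches d D j)) / fact d
               * (\<Prod>i<d. inducibility d (branch d D i))
         \<and> ((\<forall>i<d. \<forall>j<d. num_leaves (branch d D i) = num_leaves (branch d D j)
                \<longrightarrow> isomorphic (branch d D i) (branch d D j))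
            \<longrightarrow> inducibility d (Some D) \<le> (\<Prod>i<d. inducibility d (branch d D i)))"
proof -
  obtain ds where ds: "D = Node ds"
    by (cases D)
  have "ds \<noteq> []"
    using assms(3) ds by (auto simp: num_leaves_leaf)
  then have le: "inducibility d (Some D) \<le> weight d D M * (\<Prod>i<d. inducibility d (branch d D i))"
    using assms inducibility_le_weight unfolding ds by blast
  let ?I = "\<Prod>i<d. inducibility d (branch d D i)"
  have I0: "0 \<le> ?I"
    using assms(1) by (intro prod_nonneg inducibility_nonneg)
  have "real (card (size_symmetries d D)) \<le> (\<Prod>j. fact (num_branches d D j))"
  proof -
    have "real (card (size_symmetries d D)) \<le>
        real (\<Prod>v\<in>(\<lambda>i. num_leaves (branch d D i)) ` {..<d}. fact (num_branches d D v))"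
      unfolding num_branches_def of_nat_le_iff by (rule card_symmetries_le)
    then show ?thesis
      by (simp add: Prod_any_num_branches)
  qed
  then have "weight d D M * ?I \<le> real (card M) * (\<Prod>j. fact (num_branches d D j)) / fact d * ?I"
    using I0 by (intro mult_right_mono divide_right_mono mult_left_mono) auto
  moreover have "weight d D M = 1"
    if same: "\<forall>i<d. \<forall>j<d. num_leaves (branch d D i) = num_leaves (branch d D j)
      \<longrightarrow> isomorphic (branch d D i) (branch d D j)"
  proof -
    \<comment> \<open>Isomorphic branches always have equally many leaves, and \<open>same\<close>
      is the converse.\<close>
    have "size_symmetries d D = branch_symmetries d D"
    proof (intro Collect_cong conj_cong refl all_cong1 imp_cong)
      fix h i assume "h permutes {..<d}" "i < d"
      then have "h i < d"
        using permutes_in_image[of h "{..<d}" i] by simp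
      then show "num_leaves (branch d D (h i)) = num_leaves (branch d D i) \<longleftrightarrow>
          isomorphic (branch d D (h i)) (branch d D i)"
        using same \<open>i < d\<close> isomorphic_num_leaves by blast
    qed
    then show ?thesis
      using card_representatives[OF assms(4)] by (simp add: mult.commute)
  qed
  ultimately show ?thesis
    using le by (auto simp only: mult_1 intro: order_trans)
qed

end
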